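(* Consider SAEF-SGD (step-ahead error feedback without momentum, without error averaging, with double-way compression, as defined in the context) run for $T$ iterations with $K$ workers. Suppose Assumptions (A1) ($L$-Lipschitz gradient), (A2) (bounded variance), (A3) (bounded second moment) and (A4) ($\delta$-approximate compressor) of the context hold, and that the learning rate satisfies $0<\eta_t=\eta<\frac{3}{2L}$ for all $t=0,\dots,T-1$. Then $$\min_{t=0,\dots,T-1}\mathbb{E}\|\nabla F(x^{(k)}_t)\|_2^2\le \frac{4[F(x_0)-F(x^* )]}{\eta(3-2\eta L)T}+\frac{4\eta L\sigma^2}{(3-2\eta L)K}+\left(2+\frac{8C}{3-2\eta L}\right)\frac{1-\delta}{(1-\sqrt{1-\delta})^2}\,\eta^2L^2(M^2+\sigma^2),$$ where $C=\frac{2(1+\delta)(2-\delta)}{(1-\sqrt{1-\delta})^2}+\frac{1+\delta}{\delta}$.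
   Context: Problem: minimize $F(x)=\mathbb{E}_{\xi\sim\mathcal{D}}f(x;\xi)$ over $x\in\mathbb{R}^d$; $x^*$ denotes a minimizer of $F$. The data distribution $\mathcal D$ is identical across all $K$ workers; $\xi^{(k)}_t$ is the random sample used by worker $k$ at iteration $t$, and stochastic gradients are unbiased. SAEF-SGD (no momentum, no error averaging). Let $\mathcal{C}:\mathbb{R}^d\to\mathbb{R}^d$ be a compression function and $\eta_t$ the learning rates. Start from a given $x_0\in\mathbb{R}^d$, local errors $e^{(k)}_0=0$ for $1\le k\le K$ and server error $e_0=0$. All workers hold the same model $x^{(k)}_t=x_t$. For $t=0,\dots,T-1$: each worker $k$ computes $x^{(k)}_{t+\frac12}=x^{(k)}_t-e^{(k)}_t$, $\Delta^{(k)}_{t+1}=e^{(k)}_t+\eta_t\nabla f(x^{(k)}_{t+\frac12};\xi^{(k)}_t)$, $e^{(k)}_{t+1}=\Delta^{(k)}_{t+1}-\mathcal{C}(\Delta^{(k)}_{t+1})$; the server computes $\Delta_{t+1}=e_t+\frac1K\sum_{k=1}^K\mathcal{C}(\Delta^{(k)}_{t+1})$, $e_{t+1}=\Delta_{t+1}-\mathcal{C}(\Delta_{t+1})$; then $x^{(k)}_{t+1}=x^{(k)}_t-\mathcal{C}(\Delta_{t+1})$ for all workers. Assumptions. (A1) $\|\nabla F(x)-\nabla F(y)\|_2\le L\|x-y\|_2$ for all $x,y\in\mathbb{R}^d$. (A2) The stochastic gradient has bounded variance: $\mathbb{E}\|\nabla f(x^{(k)}_t;\xi^{(k)}_t)-\nabla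 F(x^{(k)}_t)\|_2^2\le\sigma^2$. (A3) The full gradient is bounded: $\|\nabla F(x^{(k)}_t)\|_2^2\le M^2$ (together with (A2) this gives $\mathbb{E}\|\nabla f(x^{(k)}_t;\xi^{(k)}_t)\|_2^2\le\sigma^2+M^2$). (A4) $0<\delta\le1$ and $\|\mathcal{C}(v)-v\|_2^2\le(1-\delta)\|v\|_2^2$ for all $v\in\mathbb{R}^d$.
   Formalization: Assumptions (A2) and (A3) are required at the half-step points x_{t+1/2}^(k), where the algorithm evaluates its stochastic gradients, as well as at x_t^(k); with bounds only at x_t^(k) the claim fails. *)

theory Defs
  imports "HOL-Probability.Probability"
begin

text \<open>
  Step-ahead error feedback SGD with two-way compression, along a fixed sample path:
  \<open>G t k x\<close> is the stochastic gradient that worker \<open>k\<close> obtains at the point \<open>x\<close> in iteration \<open>t\<close>.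
  Workers are numbered \<open>1, \<dots>, K\<close>; the components at other indices are never read by the server.
\<close>

record 'a saef_state =
  model :: "nat \<Rightarrow> 'a"
  local_error :: "nat \<Rightarrow> 'a"
  server_error :: 'a

text \<open>The point \<open>x\<^sup>(\<^sup>k\<^sup>)\<close> at time \<open>t + 1/2\<close>, computed from the state at time \<open>t\<close>.\<close>

definition half_step :: "'a::real_vector saef_state \<Rightarrow> nat \<Rightarrow> 'a" where
  "half_step s k = model s k - local_error s k"

definition saef_step ::
    "('a::real_vector \<Rightarrow> 'a) \<Rightarrow> nat \<Rightarrow> real \<Rightarrow> (nat \<Rightarrow> 'a \<Rightarrow> 'a) \<Rightarrow> 'a saef_state \<Rightarrow> 'a saef_state"
  where
  "saef_step \<C> K \<eta> G s =
    (let \<Delta>loc = (\<lambda>k. local_error s k + \<eta> *\<^sub>R G k (half_step s k));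
         \<Delta> = server_error s + (1 / real K) *\<^sub>R (\<Sum>k = 1..K. \<C> (\<Delta>loc k))
     in \<lparr> model = (\<lambda>k. model s k - \<C> \<Delta>),
          local_error = (\<lambda>k. \<Delta>loc k - \<C> (\<Delta>loc k)),
          server_error = \<Delta> - \<C> \<Delta> \<rparr>)"

primrec saef ::
    "('a::real_vector \<Rightarrow> 'a) \<Rightarrow> nat \<Rightarrow> (nat \<Rightarrow> real) \<Rightarrow> 'a \<Rightarrow> (nat \<Rightarrow> nat \<Rightarrow> 'a \<Rightarrow> 'a) \<Rightarrow> nat \<Rightarrow> 'a saef_state"
  where
  "saef \<C> K \<eta> x0 G 0 = \<lparr> model = (\<lambda>k. x0), local_error = (\<lambda>k. 0), server_error = 0 \<rparr>"
| "saef \<C> K \<eta> x0 G (Suc t) = saef_step \<C> K (\<eta> t) (G t) (saef \<C> K \<eta> x0 G t)"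

end

theory Submission
  imports Defs
begin

text \<open>
  The virtual iterate, obtained from the iterate by subtracting the server error and the mean
  local error, moves by exactly \<open>- \<eta>\<close> times the mean stochastic gradient, so the
  descent lemma applies to it. The sampling noise is orthogonal to everything that does not depend
  on the sample in question, hence its linear contribution vanishes in expectation and its quadratic
  one is reduced by the factor \<open>1 / K\<close>. What remains is the distance between iterate, half
  steps and virtual iterate, which is controlled by geometric series for the root mean squares of
  the compression errors with ratio \<open>sqrt (1 - \<delta>)\<close>.
\<close>

subsection \<open>Square-integrable random vectors\<close>

text \<open>Three gradients have to be reconciled: the claim speaks of the iterate, the update
  samples at the half steps, and the descent lemma uses the virtual iterate. Differences are
  measured by root mean squares, because these add by Minkowski. Squared bounds would need a tuned
  Young parameter at every step and lose constants. With \<open>s = sqrt (1 - \<delta>)\<close> and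
  \<open>G\<close> bounding the stochastic gradients, the local errors obey the recursion
  \<open>y \<mapsto> s * (y + \<eta> * G)\<close>, whose fixed point is
  \<open>s / (1 - s) * (\<eta> * G)\<close>. The compressed vectors sent to the server have size at
  most \<open>(1 + s) / (1 - s) * (\<eta> * G)\<close>, and the server error obeys the same
  recursion driven by that size. Local errors count twice and the server error once, which gives the
  factor \<open>2 + (1 + s) / (1 - s) = (3 - s) / (1 - s)\<close>. The constant \<open>C\<close>
  enters only at the end, as an upper bound: the square of this factor is at most
  \<open>2 * C\<close>. Orthogonality of the noise is obtained from product measures and Fubini,
  over sigma-algebras generated by arbitrary sets of samples.\<close>

definition l2_bound :: "'w measure \<Rightarrow> ('w \<Rightarrow> 'a::euclidean_space) \<Rightarrow> real \<Rightarrow> bool" where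
  "l2_bound N Y c \<longleftrightarrow> Y \<in> borel_measurable N \<and> integrable N (\<lambda>\<omega>. (norm (Y \<omega>))\<^sup>2) \<and>
     (\<integral>\<omega>. (norm (Y \<omega>))\<^sup>2 \<partial>N) \<le> c\<^sup>2"

lemma l2_boundD:
  assumes "l2_bound N Y c"
  shows "Y \<in> borel_measurable N" "integrable N (\<lambda>\<omega>. (norm (Y \<omega>))\<^sup>2)"
    "(\<integral>\<omega>. (norm (Y \<omega>))\<^sup>2 \<partial>N) \<le> c\<^sup>2"
  using assms by (auto simp: l2_bound_def)

text \<open>Domination almost everywhere is enough, which is what the degenerate case of
  \<open>l2_bound_add\<close> needs: a summand with bound 0 vanishes only almost surely.\<close>

lemma l2_bound_dominated:
  fixes Y :: "'w \<Rightarrow> 'a::euclidean_space" and Z :: "'w \<Rightarrow> 'b::euclidean_space"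
  assumes Y: "l2_bound N Y c" and Z: "Z \<in> borel_measurable N"
    and le: "AE \<omega> in N. norm (Z \<omega>) \<le> a * norm (Y \<omega>)"
  shows "l2_bound N Z (a * c)"
proof -
  have le2: "AE \<omega> in N. (norm (Z \<omega>))\<^sup>2 \<le> a\<^sup>2 * (norm (Y \<omega>))\<^sup>2"
    using le
  proof eventually_elim
    case (elim \<omega>)
    then have "(norm (Z \<omega>))\<^sup>2 \<le> (a * norm (Y \<omega>))\<^sup>2"
      by (intro power_mono) auto
    then show ?case by (simp add: power_mult_distrib)
  qed
  have iY: "integrable N (\<lambda>\<omega>. a\<^sup>2 * (norm (Y \<omega>))\<^sup>2)"
    using l2_boundD(2)[OF Y] by simp
  have iZ: "integrable N (\<lambda>\<omega>. (norm (Z \<omega>))\<^sup>2)"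
    by (rule Bochner_Integration.integrable_bound[OF iY]) (use Z le2 in auto)
  have "(\<integral>\<omega>. (norm (Z \<omega>))\<^sup>2 \<partial>N) \<le> (\<integral>\<omega>. a\<^sup>2 * (norm (Y \<omega>))\<^sup>2 \<partial>N)"
    by (rule integral_mono_AE[OF iZ iY le2])
  also have "\<dots> \<le> a\<^sup>2 * c\<^sup>2"
    using l2_boundD(3)[OF Y] by (simp add: mult_left_mono)
  finally show ?thesis
    using Z iZ by (simp add: l2_bound_def power_mult_distrib)
qed

text \<open>No sign condition on \<open>a\<close> is needed, since a bound enters
  \<open>l2_bound\<close> only through its square.\<close>

lemma l2_bound_scaleR:
  assumes "l2_bound N Y c"
  shows "l2_bound N (\<lambda>\<omega>. a *\<^sub>R Y \<omega>) (a * c)"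
proof -
  have "l2_bound N (\<lambda>\<omega>. a *\<^sub>R Y \<omega>) (\<bar>a\<bar> * c)"
    by (rule l2_bound_dominated[OF assms]) (use l2_boundD(1)[OF assms] in auto)
  then show ?thesis by (simp add: l2_bound_def power_mult_distrib)
qed

lemma l2_bound_norm:
  assumes "l2_bound N Y c"
  shows "l2_bound N (\<lambda>\<omega>. norm (Y \<omega>)) c"
  using assms by (auto simp: l2_bound_def)

lemma l2_bound_zero: "l2_bound N (\<lambda>_. 0) 0"
  by (simp add: l2_bound_def)

text \<open>Young's inequality with the weight \<open>b / a\<close>, which is optimal when
  \<open>a\<close> and \<open>b\<close> are the sizes of \<open>y\<close> and \<open>z\<close>:
  replacing the norms by \<open>a\<close> and \<open>b\<close> turns the right-hand side into
  exactly \<open>(a + b)\<^sup>2\<close>. This is how \<open>l2_bound_add\<close> obtains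
  Minkowski's inequality.\<close>

lemma norm_add_power2_le:
  fixes y z :: "'a::real_normed_vector"
  assumes "0 < a" "0 < b"
  shows "(norm (y + z))\<^sup>2 \<le> (1 + b / a) * (norm y)\<^sup>2 + (1 + a / b) * (norm z)\<^sup>2"
proof -
  have "0 \<le> (b * norm y - a * norm z)\<^sup>2 / (a * b)"
    using assms by simp
  also have "\<dots> = b / a * (norm y)\<^sup>2 + a / b * (norm z)\<^sup>2 - 2 * norm y * norm z"
    using assms by (simp add: field_simps power2_eq_square)
  finally have *: "2 * norm y * norm z \<le> b / a * (norm y)\<^sup>2 + a / b * (norm z)\<^sup>2" by simp
  have "(norm (y + z))\<^sup>2 \<le> (norm y + norm z)\<^sup>2"
    by (intro power_mono norm_triangle_ineq) auto
  also have "\<dots> = (norm y)\<^sup>2 + (norm z)\<^sup>2 + 2 * norm y * norm z"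
    by (simp add: power2_sum)
  finally show ?thesis using * by (simp add: algebra_simps)
qed

lemma l2_bound_zero_AE:
  assumes "l2_bound N Y 0"
  shows "AE \<omega> in N. Y \<omega> = 0"
proof -
  have "(\<integral>\<omega>. (norm (Y \<omega>))\<^sup>2 \<partial>N) \<le> 0" using l2_boundD(3)[OF assms] by simp
  moreover have "(\<integral>\<omega>. (norm (Y \<omega>))\<^sup>2 \<partial>N) \<ge> 0" by simp
  ultimately have "(\<integral>\<omega>. (norm (Y \<omega>))\<^sup>2 \<partial>N) = 0" by linarith
  then have "AE \<omega> in N. (norm (Y \<omega>))\<^sup>2 = 0"
    by (subst (asm) integral_nonneg_eq_0_iff_AE[OF l2_boundD(2)[OF assms]]) auto
  then show ?thesis by auto
qed

lemma l2_bound_add: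
  assumes Y: "l2_bound N Y a" and Z: "l2_bound N Z b" and "0 \<le> a" "0 \<le> b"
  shows "l2_bound N (\<lambda>\<omega>. Y \<omega> + Z \<omega>) (a + b)"
proof -
  note [measurable] = l2_boundD(1)[OF Y] l2_boundD(1)[OF Z]
  consider "a = 0" | "b = 0" | "0 < a" "0 < b" using assms by linarith
  then show ?thesis
  proof cases
    case 1
    then have "AE \<omega> in N. norm (Y \<omega> + Z \<omega>) \<le> 1 * norm (Z \<omega>)"
      using l2_bound_zero_AE Y by fastforce
    then show ?thesis using l2_bound_dominated[OF Z, of "\<lambda>\<omega>. Y \<omega> + Z \<omega>" 1] 1 by simp
  next
    case 2
    then have "AE \<omega> in N. norm (Y \<omega> + Z \<omega>) \<le> 1 * norm (Y \<omega>)"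
      using l2_bound_zero_AE Z by fastforce
    then show ?thesis using l2_bound_dominated[OF Y, of "\<lambda>\<omega>. Y \<omega> + Z \<omega>" 1] 2 by simp
  next
    case 3
    let ?R = "\<lambda>\<omega>. (1 + b / a) * (norm (Y \<omega>))\<^sup>2 + (1 + a / b) * (norm (Z \<omega>))\<^sup>2"
    have le: "(norm (Y \<omega> + Z \<omega>))\<^sup>2 \<le> ?R \<omega>" for \<omega>
      by (rule norm_add_power2_le[OF 3])
    have iR: "integrable N ?R"
      using l2_boundD(2)[OF Y] l2_boundD(2)[OF Z] by simp
    have i: "integrable N (\<lambda>\<omega>. (norm (Y \<omega> + Z \<omega>))\<^sup>2)"
    proof (rule Bochner_Integration.integrable_bound[OF iR])
      show "AE \<omega> in N. norm ((norm (Y \<omega> + Z \<omega>))\<^sup>2) \<le> norm (?R \<omega>)"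
        using le order_trans[OF le abs_ge_self] by (intro AE_I2) simp
    qed measurable
    have "(\<integral>\<omega>. (norm (Y \<omega> + Z \<omega>))\<^sup>2 \<partial>N) \<le> (\<integral>\<omega>. ?R \<omega> \<partial>N)"
      by (rule integral_mono[OF i iR le])
    also have "\<dots> = (1 + b / a) * (\<integral>\<omega>. (norm (Y \<omega>))\<^sup>2 \<partial>N) + (1 + a / b) * (\<integral>\<omega>. (norm (Z \<omega>))\<^sup>2 \<partial>N)"
      using l2_boundD(2)[OF Y] l2_boundD(2)[OF Z] by simp
    also have "\<dots> \<le> (1 + b / a) * a\<^sup>2 + (1 + a / b) * b\<^sup>2"
      using l2_boundD(3)[OF Y] l2_boundD(3)[OF Z] 3 by (intro add_mono mult_left_mono) auto
    also have "\<dots> = (a + b)\<^sup>2"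
      using 3 by (simp add: field_simps power2_eq_square)
    finally show ?thesis using i by (simp add: l2_bound_def)
  qed
qed

lemma l2_bound_sum:
  assumes "finite A" "\<And>i. i \<in> A \<Longrightarrow> l2_bound N (Y i) (c i)" "\<And>i. i \<in> A \<Longrightarrow> 0 \<le> c i"
  shows "l2_bound N (\<lambda>\<omega>. \<Sum>i\<in>A. Y i \<omega>) (\<Sum>i\<in>A. c i)"
  using assms by (induction A rule: finite_induct)
    (auto simp: l2_bound_zero intro!: l2_bound_add sum_nonneg)

lemma l2_bound_mean:
  assumes "1 \<le> K" "\<And>k. k \<in> {1..K} \<Longrightarrow> l2_bound N (Y k) c" "0 \<le> c"
  shows "l2_bound N (\<lambda>\<omega>. (1 / real K) *\<^sub>R (\<Sum>k = 1..K. Y k \<omega>)) c"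
  using l2_bound_scaleR[OF l2_bound_sum[of "{1..K}" N Y "\<lambda>_. c"], of "1 / real K"] assms by simp

lemma integrable_inner_l2:
  fixes Y Z :: "'w \<Rightarrow> 'a::euclidean_space"
  assumes Y: "l2_bound N Y a" and Z: "l2_bound N Z b"
  shows "integrable N (\<lambda>\<omega>. Y \<omega> \<bullet> Z \<omega>)"
proof (rule Bochner_Integration.integrable_bound)
  show "integrable N (\<lambda>\<omega>. (norm (Y \<omega>))\<^sup>2 + (norm (Z \<omega>))\<^sup>2)"
    using l2_boundD(2)[OF Y] l2_boundD(2)[OF Z] by simp
  have "\<bar>Y \<omega> \<bullet> Z \<omega>\<bar> \<le> (norm (Y \<omega>))\<^sup>2 + (norm (Z \<omega>))\<^sup>2" for \<omega>
  proof -
    have "\<bar>Y \<omega> \<bullet> Z \<omega>\<bar> \<le> norm (Y \<omega>) * norm (Z \<omega>)" by (rule Cauchy_Schwarz_ineq2)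
    also have "\<dots> \<le> 2 * norm (Y \<omega>) * norm (Z \<omega>)" by simp
    also have "\<dots> \<le> (norm (Y \<omega>))\<^sup>2 + (norm (Z \<omega>))\<^sup>2" by (rule sum_squares_bound)
    finally show ?thesis .
  qed
  then show "AE \<omega> in N. norm (Y \<omega> \<bullet> Z \<omega>) \<le> norm ((norm (Y \<omega>))\<^sup>2 + (norm (Z \<omega>))\<^sup>2)"
    by (intro AE_I2) simp
qed (use l2_boundD(1)[OF Y] l2_boundD(1)[OF Z] in measurable)

lemma (in prob_space) l2_bound_AE_bounded:
  assumes "Y \<in> borel_measurable M" "AE \<omega> in M. (norm (Y \<omega>))\<^sup>2 \<le> c\<^sup>2"
  shows "l2_bound M Y c"
proof -
  have "l2_bound M (\<lambda>_. 1::real) 1"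
    by (simp add: l2_bound_def prob_space)
  moreover have "AE \<omega> in M. norm (Y \<omega>) \<le> \<bar>c\<bar> * norm (1::real)"
    using assms(2) by eventually_elim (simp add: abs_le_square_iff[symmetric])
  ultimately have "l2_bound M Y (\<bar>c\<bar> * 1)"
    using assms(1) l2_bound_dominated by blast
  then show ?thesis by (simp add: l2_bound_def)
qed

text \<open>The history \<open>\<omega>\<close> and the fresh sample \<open>s\<close> are separate
  arguments of \<open>h\<close>. By independence their joint law is a product, so Fubini allows
  averaging over \<open>s\<close> with the history frozen, where \<open>mean_h\<close> applies. Here
  \<open>distr M \<A> (\<lambda>\<omega>. \<omega>)\<close> is the restriction of the measure to the
  sub-sigma-algebra.\<close>

lemma (in prob_space) expectation_inner_indep_eq_0:
  fixes \<A> :: "'a measure" and \<D> :: "'s measure" and \<xi> :: "'a \<Rightarrow> 's"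
    and W :: "'a \<Rightarrow> 'b::euclidean_space" and h :: "'a \<Rightarrow> 's \<Rightarrow> 'b"
  assumes sub: "subalgebra M \<A>" and \<xi>: "\<xi> \<in> M \<rightarrow>\<^sub>M \<D>"
    and indep: "\<And>A B. A \<in> sets \<A> \<Longrightarrow> B \<in> sets \<D> \<Longrightarrow>
      prob (A \<inter> (\<xi> -` B \<inter> space M)) = prob A * prob (\<xi> -` B \<inter> space M)"
    and W [measurable]: "W \<in> borel_measurable \<A>"
    and h [measurable]: "(\<lambda>(\<omega>, s). h \<omega> s) \<in> borel_measurable (\<A> \<Otimes>\<^sub>M \<D>)"
    and int_h: "\<And>\<omega>. integrable (distr M \<D> \<xi>) (h \<omega>)"
    and mean_h: "\<And>\<omega>. (\<integral>s. h \<omega> s \<partial>distr M \<D> \<xi>) = 0"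
    and int: "integrable M (\<lambda>\<omega>. W \<omega> \<bullet> h \<omega> (\<xi> \<omega>))"
  shows "(\<integral>\<omega>. W \<omega> \<bullet> h \<omega> (\<xi> \<omega>) \<partial>M) = 0"
proof -
  have rv: "(\<lambda>\<omega>. \<omega>) \<in> M \<rightarrow>\<^sub>M \<A>" "\<xi> \<in> M \<rightarrow>\<^sub>M \<D>"
    using sub \<xi> by (auto simp: subalgebra_def measurable_def)
  note emeasure_M = emeasure_eq_measure
  interpret A: prob_space "distr M \<A> (\<lambda>\<omega>. \<omega>)" by (rule prob_space_distr[OF rv(1)])
  interpret D: prob_space "distr M \<D> \<xi>" by (rule prob_space_distr[OF rv(2)])
  interpret pair_prob_space "distr M \<A> (\<lambda>\<omega>. \<omega>)" "distr M \<D> \<xi>" ..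
  have pair: "(\<lambda>\<omega>. (\<omega>, \<xi> \<omega>)) \<in> M \<rightarrow>\<^sub>M \<A> \<Otimes>\<^sub>M \<D>" using rv by measurable
  \<comment> \<open>Rectangles form an intersection-stable generator of the product sigma-algebra,
    so the factorization \<open>indep\<close> on them already determines the joint law.\<close>
  have eq: "distr M \<A> (\<lambda>\<omega>. \<omega>) \<Otimes>\<^sub>M distr M \<D> \<xi> = distr M (\<A> \<Otimes>\<^sub>M \<D>) (\<lambda>\<omega>. (\<omega>, \<xi> \<omega>))"
  proof (rule pair_measure_eqI)
    fix A B assume "A \<in> sets (distr M \<A> (\<lambda>\<omega>. \<omega>))" "B \<in> sets (distr M \<D> \<xi>)"
    then have AB [measurable]: "A \<in> sets \<A>" "B \<in> sets \<D>" by auto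
    then have "A \<subseteq> space M" using sub by (metis sets.sets_into_space subalgebra_def)
    then have vim: "(\<lambda>\<omega>. \<omega>) -` A \<inter> space M = A"
      "(\<lambda>\<omega>. (\<omega>, \<xi> \<omega>)) -` (A \<times> B) \<inter> space M = A \<inter> (\<xi> -` B \<inter> space M)"
      by auto
    show "emeasure (distr M \<A> (\<lambda>\<omega>. \<omega>)) A * emeasure (distr M \<D> \<xi>) B
      = emeasure (distr M (\<A> \<Otimes>\<^sub>M \<D>) (\<lambda>\<omega>. (\<omega>, \<xi> \<omega>))) (A \<times> B)"
    proof -
      have "emeasure (distr M \<A> (\<lambda>\<omega>. \<omega>)) A * emeasure (distr M \<D> \<xi>) B
        = ennreal (measure M A) * ennreal (measure M (\<xi> -` B \<inter> space M))"
        by (simp only: emeasure_distr[OF rv(1) AB(1)] emeasure_distr[OF rv(2) AB(2)] vim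
            emeasure_M)
      also have "\<dots> = ennreal (measure M (A \<inter> (\<xi> -` B \<inter> space M)))"
        using ennreal_mult[of "measure M A" "measure M (\<xi> -` B \<inter> space M)"] indep[OF AB] by simp
      also have "\<dots> = emeasure (distr M (\<A> \<Otimes>\<^sub>M \<D>) (\<lambda>\<omega>. (\<omega>, \<xi> \<omega>))) (A \<times> B)"
        by (simp only: emeasure_distr[OF pair pair_measureI[OF AB]] vim emeasure_M)
      finally show ?thesis .
    qed
  next
    show "sets (distr M \<A> (\<lambda>\<omega>. \<omega>) \<Otimes>\<^sub>M distr M \<D> \<xi>)
      = sets (distr M (\<A> \<Otimes>\<^sub>M \<D>) (\<lambda>\<omega>. (\<omega>, \<xi> \<omega>)))"
      using sets_pair_measure_cong[OF sets_distr sets_distr] by simp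
  qed (fact A.sigma_finite_measure_axioms D.sigma_finite_measure_axioms)+
  let ?H = "\<lambda>(\<omega>, s). W \<omega> \<bullet> h \<omega> s"
  have H: "?H \<in> borel_measurable (\<A> \<Otimes>\<^sub>M \<D>)" by measurable
  have intH: "integrable (distr M \<A> (\<lambda>\<omega>. \<omega>) \<Otimes>\<^sub>M distr M \<D> \<xi>) ?H"
    unfolding eq using int integrable_distr_eq[OF pair H] by simp
  have "(\<integral>\<omega>. W \<omega> \<bullet> h \<omega> (\<xi> \<omega>) \<partial>M) = integral\<^sup>L (distr M (\<A> \<Otimes>\<^sub>M \<D>) (\<lambda>\<omega>. (\<omega>, \<xi> \<omega>))) ?H"
    using integral_distr[OF pair H] by simp
  also have "\<dots> = (\<integral>\<omega>. (\<integral>s. W \<omega> \<bullet> h \<omega> s \<partial>distr M \<D> \<xi>) \<partial>distr M \<A> (\<lambda>\<omega>. \<omega>))"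
    using integral_fst'[OF intH] unfolding eq by simp
  also have "\<dots> = 0" using int_h mean_h by simp
  finally show ?thesis .
qed

subsection \<open>Deterministic inequalities\<close>

text \<open>On the segment from \<open>x\<close> to \<open>x + d\<close>, \<open>\<phi>\<close> is
  \<open>F\<close> minus its linear part and the quadratic majorant. The Lipschitz bound makes its
  derivative nonpositive for \<open>u \<ge> 0\<close>, and the claim is
  \<open>\<phi> 1 \<le> \<phi> 0\<close>.\<close>

lemma descent_lemma:
  fixes F :: "'a::euclidean_space \<Rightarrow> real"
  assumes G: "\<And>x. GDERIV F x :> grad x"
    and Lip: "\<And>x y. norm (grad x - grad y) \<le> L * norm (x - y)"
  shows "F (x + d) \<le> F x + grad x \<bullet> d + L / 2 * (norm d)\<^sup>2"
proof -
  define \<phi> where "\<phi> u = F (x + u *\<^sub>R d) - u * (grad x \<bullet> d) - L / 2 * u\<^sup>2 * (norm d)\<^sup>2" for u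
  define \<phi>' where "\<phi>' u = grad (x + u *\<^sub>R d) \<bullet> d - grad x \<bullet> d - L * u * (norm d)\<^sup>2" for u
  have F': "(F has_derivative (\<lambda>h. h \<bullet> grad y)) (at y)" for y
    using G[of y] unfolding gderiv_def .
  have "((\<lambda>u. F (x + u *\<^sub>R d)) has_derivative (\<lambda>h. (h *\<^sub>R d) \<bullet> grad (x + u *\<^sub>R d))) (at u)" for u :: real
    by (rule has_derivative_compose[OF _ F']) (auto intro!: derivative_eq_intros)
  then have line: "((\<lambda>u. F (x + u *\<^sub>R d)) has_real_derivative (grad (x + u *\<^sub>R d) \<bullet> d)) (at u)" for u
    unfolding has_field_derivative_def
    by (rule has_derivative_eq_rhs) (auto simp: inner_commute)
  have D: "(\<phi> has_real_derivative \<phi>' u) (at u)" for u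
    unfolding \<phi>_def \<phi>'_def
    by (rule derivative_eq_intros line refl | simp)+
  have "\<phi>' u \<le> 0" if "0 \<le> u" for u
  proof -
    have "(grad (x + u *\<^sub>R d) - grad x) \<bullet> d \<le> norm (grad (x + u *\<^sub>R d) - grad x) * norm d"
      by (rule norm_cauchy_schwarz)
    also have "\<dots> \<le> (L * norm (u *\<^sub>R d)) * norm d"
      using Lip[of "x + u *\<^sub>R d" x] by (intro mult_right_mono) auto
    also have "\<dots> = L * u * (norm d)\<^sup>2" using that by (simp add: power2_eq_square)
    finally show ?thesis by (simp add: \<phi>'_def inner_diff_left)
  qed
  then have "\<phi> 1 \<le> \<phi> 0"
    using D by (intro DERIV_nonpos_imp_nonincreasing[of 0 1 \<phi>]) (simp, blast)
  then show ?thesis by (simp add: \<phi>_def)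
qed

text \<open>
  Here \<open>g\<close>, \<open>h\<close>, \<open>p\<close> are the gradient at the iterate, the mean gradient at the half
  steps, and the gradient at the virtual iterate. Comparing directly with \<open>g\<close>, instead of
  bounding \<open>h\<close> first and \<open>g\<close> by \<open>h\<close> afterwards, saves a factor 2 in front of the initial gap.
\<close>

lemma virtual_descent_inequality:
  fixes g h p :: "'a::real_inner"
  assumes "0 \<le> \<eta>" "0 \<le> \<eta> * L" "\<eta> * L \<le> 3 / 2"
  shows "- \<eta> * (p \<bullet> h) + L / 2 * \<eta>\<^sup>2 * (norm h)\<^sup>2
    \<le> - (\<eta> * (3 - 2 * \<eta> * L) / 4) * (norm g)\<^sup>2 + \<eta> * (norm (h - g) + norm (p - g))\<^sup>2"
proof -
  define a b c where "a = h - g" and "b = p - g" and "c = \<eta> * L"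
  have c: "0 \<le> c" "c \<le> 3 / 2" using assms by (auto simp: c_def)
  have hp: "h = g + a" "p = g + b" by (auto simp: a_def b_def)
  have "0 \<le> (norm ((1/2) *\<^sub>R g + (1 - c) *\<^sub>R a + b))\<^sup>2" by simp
  also have "\<dots> = 1/4 * (norm g)\<^sup>2 + (1 - c) * (g \<bullet> a) + g \<bullet> b + (1 - c)\<^sup>2 * (norm a)\<^sup>2
      + (norm b)\<^sup>2 + 2 * (1 - c) * (a \<bullet> b)"
    unfolding power2_norm_eq_inner
    by (simp add: inner_simps inner_commute power2_eq_square algebra_simps)
  finally have sq: "0 \<le> 1/4 * (norm g)\<^sup>2 + (1 - c) * (g \<bullet> a) + g \<bullet> b + (1 - c)\<^sup>2 * (norm a)\<^sup>2
      + (norm b)\<^sup>2 + 2 * (1 - c) * (a \<bullet> b)" .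
  have lhs: "- (p \<bullet> h) + c / 2 * (norm h)\<^sup>2
    = - (norm g)\<^sup>2 - g \<bullet> a - g \<bullet> b - a \<bullet> b + c / 2 * (norm g)\<^sup>2 + c * (g \<bullet> a) + c / 2 * (norm a)\<^sup>2"
    unfolding hp power2_norm_eq_inner
    by (simp add: inner_simps inner_commute algebra_simps)
  have "(1 - 2 * c) * (a \<bullet> b) \<le> \<bar>1 - 2 * c\<bar> * \<bar>a \<bullet> b\<bar>"
    by (metis abs_ge_self abs_mult)
  also have "\<dots> \<le> 2 * (norm a * norm b)"
    using c by (intro mult_mono Cauchy_Schwarz_ineq2) auto
  finally have ab: "(1 - 2 * c) * (a \<bullet> b) \<le> 2 * norm a * norm b" by simp
  \<comment> \<open>Since \<open>(1 - c)\<^sup>2 + c / 2 = 1 - c * (3 / 2 - c)\<close>, the step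
    size bound \<open>c \<le> 3 / 2\<close> is what keeps this coefficient below 1. The same range
    gave \<open>\<bar>1 - 2 * c\<bar> \<le> 2\<close> above.\<close>
  have "c * (3 / 2 - c) \<ge> 0" using c by simp
  then have "(1 - c)\<^sup>2 + c / 2 \<le> 1" by (simp add: power2_eq_square algebra_simps)
  then have aa: "((1 - c)\<^sup>2 + c / 2) * (norm a)\<^sup>2 \<le> 1 * (norm a)\<^sup>2"
    by (intro mult_right_mono) auto
  have "- (p \<bullet> h) + c / 2 * (norm h)\<^sup>2 \<le> - ((3 - 2 * c) / 4) * (norm g)\<^sup>2
      + ((1 - c)\<^sup>2 + c / 2) * (norm a)\<^sup>2 + (1 - 2 * c) * (a \<bullet> b) + (norm b)\<^sup>2"
    using sq unfolding lhs by (simp add: field_simps)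
  also have "\<dots> \<le> - ((3 - 2 * c) / 4) * (norm g)\<^sup>2 + (norm a + norm b)\<^sup>2"
    using ab aa by (simp add: power2_sum)
  finally have "\<eta> * (- (p \<bullet> h) + c / 2 * (norm h)\<^sup>2)
      \<le> \<eta> * (- ((3 - 2 * c) / 4) * (norm g)\<^sup>2 + (norm a + norm b)\<^sup>2)"
    using assms(1) by (rule mult_left_mono)
  then show ?thesis
    by (simp add: a_def b_def c_def algebra_simps power2_eq_square)
qed

text \<open>The numerator splits as \<open>(3 - s)\<^sup>2 \<le> 8 + (1 - s)\<close>, one part for
  each summand of the right-hand side. The first is covered by \<open>4 * (1 + \<delta>) * (2 -
  \<delta>) = 8 + 4 * \<delta> * (1 - \<delta>)\<close>, the second by
  \<open>\<delta> = (1 + s) * (1 - s) \<le> 2 * (1 - s)\<close>.\<close>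

lemma server_constant_le:
  fixes \<delta> :: real
  assumes "0 < \<delta>" "\<delta> \<le> 1"
  defines "s \<equiv> sqrt (1 - \<delta>)"
  shows "((3 - s) / (1 - s))\<^sup>2
    \<le> 2 * (2 * (1 + \<delta>) * (2 - \<delta>) / (1 - s)\<^sup>2 + (1 + \<delta>) / \<delta>)"
proof -
  have s: "0 \<le> s" "s < 1" using assms by (auto simp: s_def)
  have d: "\<delta> = 1 - s\<^sup>2" using assms by (simp add: s_def)
  have "0 \<le> s\<^sup>2 * (1 - s\<^sup>2)" using s by (simp add: power_le_one)
  then have A: "4 * (1 + \<delta>) * (2 - \<delta>) \<ge> 8" by (simp add: d power2_eq_square algebra_simps)
  have d2: "\<delta> \<le> 2 * (1 - s)"
  proof -
    have "\<delta> = (1 + s) * (1 - s)" by (simp add: d power2_eq_square algebra_simps)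
    also have "\<dots> \<le> 2 * (1 - s)" using s by (intro mult_right_mono) auto
    finally show ?thesis .
  qed
  have "1 / (1 - s) \<le> 2 / \<delta>"
    using d2 s assms by (simp add: divide_simps)
  also have "\<dots> \<le> 2 * (1 + \<delta>) / \<delta>" using assms by (intro divide_right_mono) auto
  finally have B: "1 / (1 - s) \<le> 2 * (1 + \<delta>) / \<delta>" .
  have "s * s \<le> 5 * s" using s by (intro mult_right_mono) auto
  then have "(3 - s)\<^sup>2 \<le> 8 + (1 - s)" using s by (simp add: power2_eq_square algebra_simps)
  then have "((3 - s) / (1 - s))\<^sup>2 \<le> (8 + (1 - s)) / (1 - s)\<^sup>2"
    unfolding power_divide by (intro divide_right_mono) auto
  also have "\<dots> = 8 / (1 - s)\<^sup>2 + 1 / (1 - s)"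
    unfolding add_divide_distrib using s by (simp add: power2_eq_square)
  also have "\<dots> \<le> 4 * (1 + \<delta>) * (2 - \<delta>) / (1 - s)\<^sup>2 + 2 * (1 + \<delta>) / \<delta>"
    using A B by (intro add_mono divide_right_mono) auto
  finally show ?thesis by (simp add: algebra_simps)
qed

text \<open>Multiplied by \<open>r\<close>, this says that \<open>r / (1 - r) * x\<close> is the
  fixed point of \<open>y \<mapsto> r * (y + x)\<close>, the recursion of both error
  sequences.\<close>

lemma geometric_step:
  fixes r x :: real
  assumes "r < 1"
  shows "r / (1 - r) * x + x = x / (1 - r)"
  using assms by (simp add: field_simps)

subsection \<open>Runs of the algorithm\<close>

abbreviation mean :: "nat \<Rightarrow> (nat \<Rightarrow> 'b::real_vector) \<Rightarrow> 'b" where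
  "mean K Y \<equiv> (1 / real K) *\<^sub>R (\<Sum>k = 1..K. Y k)"

lemma norm_mean_diff_le:
  fixes Y :: "nat \<Rightarrow> 'b::real_normed_vector"
  assumes "1 \<le> K" "\<And>k. k \<in> {1..K} \<Longrightarrow> norm (Y k - z) \<le> c k"
  shows "norm (mean K Y - z) \<le> mean K c"
proof -
  have "mean K Y - z = mean K (\<lambda>k. Y k - z)"
    using assms(1) by (simp add: sum_subtractf scaleR_diff_right sum_constant_scaleR)
  moreover have "norm (\<Sum>k = 1..K. Y k - z) \<le> (\<Sum>k = 1..K. c k)"
    using assms(2) by (intro order_trans[OF norm_sum] sum_mono) auto
  ultimately show ?thesis by (simp add: divide_right_mono)
qed

text \<open>A locale without assumptions, holding the algebra of a single sample path. It has to
  exist beforehand, because the variance and boundedness assumptions of \<open>saef_sgd\<close> are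
  stated in terms of \<open>sgrad\<close>, \<open>half\<close> and \<open>iterate\<close>.\<close>

locale saef_run =
  fixes grad_f :: "'a::euclidean_space \<Rightarrow> 's \<Rightarrow> 'a" and \<C> :: "'a \<Rightarrow> 'a"
    and \<xi> :: "nat \<Rightarrow> nat \<Rightarrow> 'w \<Rightarrow> 's" and x0 :: 'a and K :: nat and \<eta>s :: "nat \<Rightarrow> real"
begin

definition state :: "nat \<Rightarrow> 'w \<Rightarrow> 'a saef_state" where
  "state t \<omega> = saef \<C> K \<eta>s x0 (\<lambda>t k x. grad_f x (\<xi> t k \<omega>)) t"

definition iterate :: "nat \<Rightarrow> 'w \<Rightarrow> 'a" where
  "iterate t \<omega> = model (state t \<omega>) 1"

definition err :: "nat \<Rightarrow> nat \<Rightarrow> 'w \<Rightarrow> 'a" where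
  "err t k \<omega> = local_error (state t \<omega>) k"

definition srv_err :: "nat \<Rightarrow> 'w \<Rightarrow> 'a" where
  "srv_err t \<omega> = server_error (state t \<omega>)"

definition half :: "nat \<Rightarrow> nat \<Rightarrow> 'w \<Rightarrow> 'a" where
  "half t k \<omega> = iterate t \<omega> - err t k \<omega>"

definition sgrad :: "nat \<Rightarrow> nat \<Rightarrow> 'w \<Rightarrow> 'a" where
  "sgrad t k \<omega> = grad_f (half t k \<omega>) (\<xi> t k \<omega>)"

definition corrected :: "nat \<Rightarrow> nat \<Rightarrow> 'w \<Rightarrow> 'a" where
  "corrected t k \<omega> = err t k \<omega> + \<eta>s t *\<^sub>R sgrad t k \<omega>"

definition aggregated :: "nat \<Rightarrow> 'w \<Rightarrow> 'a" where
  "aggregated t \<omega> = srv_err t \<omega> + mean K (\<lambda>k. \<C> (corrected t k \<omega>))"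

definition virtual :: "nat \<Rightarrow> 'w \<Rightarrow> 'a" where
  "virtual t \<omega> = iterate t \<omega> - srv_err t \<omega> - mean K (\<lambda>k. err t k \<omega>)"

text \<open>All models start at \<open>x0\<close> and subtract the same server vector in every step,
  so worker 1 can represent every index.\<close>

lemma model_state: "model (state t \<omega>) k = iterate t \<omega>"
proof -
  have "model (state t \<omega>) k = model (state t \<omega>) l" for l
    unfolding state_def by (induction t) (simp_all add: saef_step_def Let_def)
  then show ?thesis unfolding iterate_def .
qed

lemma half_step_state: "half_step (state t \<omega>) k = half t k \<omega>"
  by (simp add: half_step_def half_def model_state err_def)

lemma run_0 [simp]: "iterate 0 \<omega> = x0" "err 0 k \<omega> = 0" "srv_err 0 \<omega> = 0"
  by (simp_all add: iterate_def err_def srv_err_def state_def)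

lemma state_Suc:
  "state (Suc t) \<omega> = saef_step \<C> K (\<eta>s t) (\<lambda>k x. grad_f x (\<xi> t k \<omega>)) (state t \<omega>)"
  by (simp add: state_def)

lemma run_Suc:
  "iterate (Suc t) \<omega> = iterate t \<omega> - \<C> (aggregated t \<omega>)"
  "err (Suc t) k \<omega> = corrected t k \<omega> - \<C> (corrected t k \<omega>)"
  "srv_err (Suc t) \<omega> = aggregated t \<omega> - \<C> (aggregated t \<omega>)"
  unfolding iterate_def[of "Suc t"] err_def[of "Suc t"] srv_err_def[of "Suc t"] state_Suc
  by (simp_all add: saef_step_def Let_def half_step_state model_state aggregated_def
      corrected_def sgrad_def flip: err_def srv_err_def)

text \<open>Both compression errors are subtracted from the virtual iterate, so they cancel in one step.\<close>

lemma virtual_Suc: "virtual (Suc t) \<omega> = virtual t \<omega> - \<eta>s t *\<^sub>R mean K (\<lambda>k. sgrad t k \<omega>)"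
  by (simp add: virtual_def run_Suc aggregated_def corrected_def sum.distrib sum_subtractf
      scaleR_add_right scaleR_diff_right scaleR_sum_right algebra_simps)

end

text \<open>\<open>B\<close> is the gradient bound of (A3), as \<open>M\<close> names the
  probability measure here. At the half steps it enters the second moment of the stochastic
  gradients; at the iterates it makes the squared gradient norms integrable.\<close>

locale saef_sgd = prob_space M + saef_run grad_f \<C> \<xi> x0 K \<eta>s
  for M :: "'w measure" and grad_f :: "'a::euclidean_space \<Rightarrow> 's \<Rightarrow> 'a" and \<C>
    and \<xi> :: "nat \<Rightarrow> nat \<Rightarrow> 'w \<Rightarrow> 's" and x0 K \<eta>s +
  fixes \<D> :: "'s measure" and F :: "'a \<Rightarrow> real" and grad_F :: "'a \<Rightarrow> 'a" and xstar :: 'a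
    and T :: nat and \<eta> L \<sigma> B \<delta> :: real
  assumes T: "1 \<le> T" and K: "1 \<le> K"
    and grad_f_measurable: "(\<lambda>(x, s). grad_f x s) \<in> borel_measurable (borel \<Otimes>\<^sub>M \<D>)"
    and gradient: "\<And>x. GDERIV F x :> grad_F x"
    and unbiased: "\<And>x. integrable \<D> (grad_f x)" "\<And>x. (\<integral>s. grad_f x s \<partial>\<D>) = grad_F x"
    and minimizer: "\<And>x. F xstar \<le> F x"
    and sample: "\<And>t k. t < T \<Longrightarrow> k \<in> {1..K} \<Longrightarrow> \<xi> t k \<in> M \<rightarrow>\<^sub>M \<D>"
      "\<And>t k. t < T \<Longrightarrow> k \<in> {1..K} \<Longrightarrow> distr M \<D> (\<xi> t k) = \<D>"
    and indep: "indep_vars (\<lambda>_. \<D>) (\<lambda>(t, k). \<xi> t k) ({..<T} \<times> {1..K})"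
    and Lipschitz: "\<And>x y. norm (grad_F x - grad_F y) \<le> L * norm (x - y)"
    and variance: "\<And>t k. t < T \<Longrightarrow> k \<in> {1..K} \<Longrightarrow>
        integrable M (\<lambda>\<omega>. (norm (sgrad t k \<omega> - grad_F (half t k \<omega>)))\<^sup>2)"
      "\<And>t k. t < T \<Longrightarrow> k \<in> {1..K} \<Longrightarrow>
        (\<integral>\<omega>. (norm (sgrad t k \<omega> - grad_F (half t k \<omega>)))\<^sup>2 \<partial>M) \<le> \<sigma>\<^sup>2"
    and bounded: "\<And>t. t < T \<Longrightarrow> AE \<omega> in M. (norm (grad_F (iterate t \<omega>)))\<^sup>2 \<le> B\<^sup>2"
      "\<And>t k. t < T \<Longrightarrow> k \<in> {1..K} \<Longrightarrow> AE \<omega> in M. (norm (grad_F (half t k \<omega>)))\<^sup>2 \<le> B\<^sup>2"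
    and \<delta>: "0 < \<delta>" "\<delta> \<le> 1"
    and compressor: "\<And>v. (norm (\<C> v - v))\<^sup>2 \<le> (1 - \<delta>) * (norm v)\<^sup>2"
    and \<C>_measurable [measurable]: "\<C> \<in> borel_measurable borel"
    and step_size: "\<And>t. t < T \<Longrightarrow> \<eta>s t = \<eta>" "0 < \<eta>" "\<eta> < 3 / (2 * L)"
begin

definition samples :: "(nat \<times> nat) set" where
  "samples = {..<T} \<times> {1..K}"

definition hist :: "(nat \<times> nat) set \<Rightarrow> 'w measure" where
  "hist J = vimage_algebra (space M) (\<lambda>\<omega>. \<lambda>i\<in>J. (case i of (t, k) \<Rightarrow> \<xi> t k) \<omega>) (PiM J (\<lambda>_. \<D>))"

definition noise :: "nat \<Rightarrow> nat \<Rightarrow> 'w \<Rightarrow> 'a" where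
  "noise t k \<omega> = sgrad t k \<omega> - grad_F (half t k \<omega>)"

abbreviation s :: real where
  "s \<equiv> sqrt (1 - \<delta>)"

abbreviation G :: real where
  "G \<equiv> sqrt (B\<^sup>2 + \<sigma>\<^sup>2)"

text \<open>For \<open>L \<le> 0\<close> the quotient \<open>3 / (2 * L)\<close> is nonpositive (0
  for \<open>L = 0\<close>, by the convention for division), and no \<open>\<eta> > 0\<close> lies
  below it.\<close>

lemma L_pos: "0 < L" and \<eta>L: "\<eta> * L < 3 / 2"
proof -
  show L: "0 < L"
  proof (rule ccontr)
    assume "\<not> 0 < L"
    then have "3 / (2 * L) \<le> 0" by (simp add: divide_nonneg_nonpos)
    then show False using step_size(2,3) by linarith
  qed
  show "\<eta> * L < 3 / 2" using step_size(3) L by (simp add: field_simps)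
qed

lemma s_range: "0 \<le> s" "s < 1"
  using \<delta> by auto

lemma compression_error: "norm (v - \<C> v) \<le> s * norm v"
proof -
  have "norm (\<C> v - v) = sqrt ((norm (\<C> v - v))\<^sup>2)" by simp
  also have "\<dots> \<le> sqrt ((1 - \<delta>) * (norm v)\<^sup>2)" by (intro real_sqrt_le_mono compressor)
  also have "\<dots> = s * norm v" by (simp add: real_sqrt_mult)
  finally show ?thesis by (simp add: norm_minus_commute)
qed

lemma norm_compressed: "norm (\<C> v) \<le> (1 + s) * norm v"
  using compression_error[of v] norm_triangle_ineq4[of v "v - \<C> v"] by (simp add: algebra_simps)

lemma grad_F_measurable [measurable]: "grad_F \<in> borel_measurable borel"
proof (rule borel_measurable_continuous_onI)
  have "L-lipschitz_on UNIV grad_F"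
    using Lipschitz L_pos by (intro lipschitz_onI) (auto simp: dist_norm)
  then show "continuous_on UNIV grad_F" by (rule lipschitz_on_continuous_on)
qed

lemma F_measurable [measurable]: "F \<in> borel_measurable borel"
proof (rule borel_measurable_continuous_onI)
  show "continuous_on UNIV F"
    using gradient unfolding gderiv_def
    by (meson UNIV_I continuous_at_imp_continuous_on has_derivative_continuous)
qed

subsection \<open>Measurability with respect to the sampled history\<close>

lemma restricted_samples_measurable:
  assumes "J \<subseteq> samples"
  shows "(\<lambda>\<omega>. \<lambda>i\<in>J. (case i of (t, k) \<Rightarrow> \<xi> t k) \<omega>) \<in> M \<rightarrow>\<^sub>M PiM J (\<lambda>_. \<D>)"
proof (rule measurable_restrict)
  fix i assume "i \<in> J"
  then show "(case i of (t, k) \<Rightarrow> \<xi> t k) \<in> M \<rightarrow>\<^sub>M \<D>"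
    using assms sample(1) by (auto simp: samples_def split: prod.splits)
qed

lemma sets_hist:
  assumes "J \<subseteq> samples"
  shows "sets (hist J) =
    {(\<lambda>\<omega>. \<lambda>i\<in>J. (case i of (t, k) \<Rightarrow> \<xi> t k) \<omega>) -` A \<inter> space M | A. A \<in> sets (PiM J (\<lambda>_. \<D>))}"
  unfolding hist_def
  by (rule sets_vimage_algebra2) (use measurable_space[OF restricted_samples_measurable[OF assms]] in auto)

lemma subalgebra_hist: "J \<subseteq> samples \<Longrightarrow> subalgebra M (hist J)"
  unfolding subalgebra_def sets_hist
  using measurable_sets[OF restricted_samples_measurable] by (auto simp: hist_def)

lemma sample_hist:
  assumes "J \<subseteq> samples" "(t, k) \<in> J"
  shows "\<xi> t k \<in> hist J \<rightarrow>\<^sub>M \<D>"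
proof -
  have "(\<lambda>\<omega>. \<lambda>i\<in>J. (case i of (t, k) \<Rightarrow> \<xi> t k) \<omega>) \<in> hist J \<rightarrow>\<^sub>M PiM J (\<lambda>_. \<D>)"
    unfolding hist_def
    by (rule measurable_vimage_algebra1)
      (use measurable_space[OF restricted_samples_measurable[OF assms(1)]] in auto)
  from measurable_compose[OF this measurable_component_singleton[OF assms(2)]]
  show ?thesis using assms(2) by simp
qed

lemma grad_f_comp_measurable:
  assumes "Y \<in> borel_measurable N" "Z \<in> N \<rightarrow>\<^sub>M \<D>"
  shows "(\<lambda>\<omega>. grad_f (Y \<omega>) (Z \<omega>)) \<in> borel_measurable N"
  using measurable_compose[OF measurable_Pair[OF assms] grad_f_measurable] by simp

text \<open>The state at time \<open>t\<close> reads only samples of earlier iterations. Any larger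
  \<open>J\<close> is allowed, so that the lemma serves both the exact past and the set of all
  samples but one. The components feed each other and need a joint induction.\<close>

lemma run_hist_measurable:
  assumes "J \<subseteq> samples" "{..<t} \<times> {1..K} \<subseteq> J"
  shows "iterate t \<in> borel_measurable (hist J)"
    and "\<And>k. k \<in> {1..K} \<Longrightarrow> err t k \<in> borel_measurable (hist J)"
    and "srv_err t \<in> borel_measurable (hist J)"
proof -
  have "iterate t \<in> borel_measurable (hist J) \<and> (\<forall>k\<in>{1..K}. err t k \<in> borel_measurable (hist J))
    \<and> srv_err t \<in> borel_measurable (hist J)"
    using assms(2)
  proof (induction t)
    case 0
    have "iterate 0 = (\<lambda>_. x0)" "err 0 k = (\<lambda>_. 0)" "srv_err 0 = (\<lambda>_. 0)" for k by auto
    then show ?case by simp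
  next
    case (Suc t)
    then have "{..<t} \<times> {1..K} \<subseteq> J" by auto
    from Suc.IH[OF this] have [measurable]: "iterate t \<in> borel_measurable (hist J)"
      "srv_err t \<in> borel_measurable (hist J)"
      and e: "\<And>k. k \<in> {1..K} \<Longrightarrow> err t k \<in> borel_measurable (hist J)"
      by auto
    have c: "corrected t k \<in> borel_measurable (hist J)" if k: "k \<in> {1..K}" for k
    proof -
      note [measurable] = e[OF k]
      have "half t k \<in> borel_measurable (hist J)"
        unfolding half_def[abs_def] by measurable
      moreover have "\<xi> t k \<in> hist J \<rightarrow>\<^sub>M \<D>"
        using Suc.prems k by (intro sample_hist[OF assms(1)]) auto
      ultimately have [measurable]: "sgrad t k \<in> borel_measurable (hist J)"
        unfolding sgrad_def[abs_def] by (rule grad_f_comp_measurable)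
      show ?thesis unfolding corrected_def[abs_def] by measurable
    qed
    have [measurable]: "(\<lambda>\<omega>. \<C> (corrected t k \<omega>)) \<in> borel_measurable (hist J)" if "k \<in> {1..K}" for k
      using measurable_compose[OF c[OF that] \<C>_measurable] .
    have [measurable]: "aggregated t \<in> borel_measurable (hist J)"
      unfolding aggregated_def[abs_def] by measurable
    have "iterate (Suc t) = (\<lambda>\<omega>. iterate t \<omega> - \<C> (aggregated t \<omega>))"
      "srv_err (Suc t) = (\<lambda>\<omega>. aggregated t \<omega> - \<C> (aggregated t \<omega>))"
      "\<And>k. err (Suc t) k = (\<lambda>\<omega>. corrected t k \<omega> - \<C> (corrected t k \<omega>))"
      by (auto simp: run_Suc)
    then show ?case using c by simp
  qed
  then show "iterate t \<in> borel_measurable (hist J)"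
    "\<And>k. k \<in> {1..K} \<Longrightarrow> err t k \<in> borel_measurable (hist J)"
    "srv_err t \<in> borel_measurable (hist J)" by auto
qed

lemma half_hist_measurable:
  assumes "J \<subseteq> samples" "{..<t} \<times> {1..K} \<subseteq> J" "k \<in> {1..K}"
  shows "half t k \<in> borel_measurable (hist J)"
  unfolding half_def[abs_def]
  by (intro borel_measurable_diff run_hist_measurable assms)

lemma sgrad_hist_measurable:
  assumes "J \<subseteq> samples" "{..<t} \<times> {1..K} \<subseteq> J" "(t, k) \<in> J"
  shows "sgrad t k \<in> borel_measurable (hist J)"
  unfolding sgrad_def[abs_def]
  using assms by (intro grad_f_comp_measurable half_hist_measurable sample_hist) (auto simp: samples_def)

lemma noise_hist_measurable:
  assumes "J \<subseteq> samples" "{..<t} \<times> {1..K} \<subseteq> J" "(t, k) \<in> J"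
  shows "noise t k \<in> borel_measurable (hist J)"
proof -
  have "k \<in> {1..K}" using assms by (auto simp: samples_def)
  then show ?thesis
    unfolding noise_def[abs_def]
    using half_hist_measurable[OF assms(1,2), of k] sgrad_hist_measurable[OF assms] by measurable
qed

lemma virtual_hist_measurable:
  assumes "J \<subseteq> samples" "{..<t} \<times> {1..K} \<subseteq> J"
  shows "virtual t \<in> borel_measurable (hist J)"
proof -
  note [measurable] = run_hist_measurable[OF assms]
  show ?thesis unfolding virtual_def[abs_def] by measurable
qed

lemma hist_measurable: "Y \<in> borel_measurable (hist samples) \<Longrightarrow> Y \<in> borel_measurable M"
  by (rule measurable_from_subalg[OF subalgebra_hist]) auto

lemma run_measurable:
  assumes "t \<le> T"
  shows "iterate t \<in> borel_measurable M"
    and "\<And>k. k \<in> {1..K} \<Longrightarrow> err t k \<in> borel_measurable M"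
    and "srv_err t \<in> borel_measurable M"
    and "virtual t \<in> borel_measurable M"
    and "\<And>k. k \<in> {1..K} \<Longrightarrow> half t k \<in> borel_measurable M"
proof -
  have J: "{..<t} \<times> {1..K} \<subseteq> samples" using assms by (auto simp: samples_def)
  show "iterate t \<in> borel_measurable M" "\<And>k. k \<in> {1..K} \<Longrightarrow> err t k \<in> borel_measurable M"
    "srv_err t \<in> borel_measurable M" "virtual t \<in> borel_measurable M"
    "\<And>k. k \<in> {1..K} \<Longrightarrow> half t k \<in> borel_measurable M"
    by (intro hist_measurable run_hist_measurable virtual_hist_measurable half_hist_measurable J
        subset_refl; simp)+
qed

lemma stochastic_measurable:
  assumes "t < T" "k \<in> {1..K}"
  shows "sgrad t k \<in> borel_measurable M" "noise t k \<in> borel_measurable M"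
  using assms
  by (auto intro!: hist_measurable sgrad_hist_measurable noise_hist_measurable simp: samples_def)

text \<open>Restrictions of an independent family to the disjoint index sets \<open>J\<close> and
  \<open>{(t, k)}\<close> are independent. This is the factorization that
  \<open>expectation_inner_indep_eq_0\<close> asks for.\<close>

lemma prob_hist_sample:
  assumes J: "J \<subseteq> samples" "(t, k) \<in> samples" "(t, k) \<notin> J"
    and A: "A \<in> sets (hist J)" and S: "S \<in> sets \<D>"
  shows "prob (A \<inter> (\<xi> t k -` S \<inter> space M)) = prob A * prob (\<xi> t k -` S \<inter> space M)"
proof -
  let ?\<xi> = "\<lambda>(t, k). \<xi> t k"
  let ?R = "\<lambda>J \<omega>. restrict (\<lambda>i. ?\<xi> i \<omega>) J"
  obtain A' where A': "A' \<in> sets (PiM J (\<lambda>_. \<D>))" "A = ?R J -` A' \<inter> space M"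
    using A unfolding sets_hist[OF J(1)] by (auto simp: case_prod_beta)
  have ind: "indep_var (PiM J (\<lambda>_. \<D>)) (?R J) (PiM {(t, k)} (\<lambda>_. \<D>)) (?R {(t, k)})"
    using J by (intro indep_var_restrict[OF indep]) (auto simp: samples_def)
  \<comment> \<open>The event about a single sample, rewritten as a cylinder in the product over the
    one index \<open>(t, k)\<close>.\<close>
  let ?S = "(\<lambda>p. p (t, k)) -` S \<inter> space (PiM {(t, k)} (\<lambda>_. \<D>))"
  have S': "?S \<in> sets (PiM {(t, k)} (\<lambda>_. \<D>))"
    using S by (intro measurable_sets[OF measurable_component_singleton]) auto
  have "?R {(t, k)} \<omega> \<in> space (PiM {(t, k)} (\<lambda>_. \<D>))" if "\<omega> \<in> space M" for \<omega>
    using J(2) that measurable_space[OF sample(1)] by (auto simp: space_PiM samples_def)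
  then have "?R {(t, k)} -` ?S \<inter> space M = \<xi> t k -` S \<inter> space M"
    "(\<lambda>\<omega>. (?R J \<omega>, ?R {(t, k)} \<omega>)) -` (A' \<times> ?S) \<inter> space M = A \<inter> (\<xi> t k -` S \<inter> space M)"
    unfolding A'(2) by auto
  then show ?thesis
    using indep_varD[OF ind A'(1) S'] A'(2) by simp
qed

subsection \<open>Moment bounds\<close>

lemma l2_bound_noise: "t < T \<Longrightarrow> k \<in> {1..K} \<Longrightarrow> l2_bound M (noise t k) \<sigma>"
  unfolding l2_bound_def using stochastic_measurable(2)[of t k] variance[of t k]
  by (simp add: noise_def)

text \<open>The half step depends on the past, which lies in \<open>hist J\<close>, while the sample
  \<open>(t, k)\<close> is fresh. With the history frozen, unbiasedness at that point annihilates
  the noise. The square integrability of \<open>W\<close> is there for the integrability that Fubini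
  needs.\<close>

lemma noise_orthogonal:
  assumes J: "J \<subseteq> samples" "{..<t} \<times> {1..K} \<subseteq> J" "(t, k) \<in> samples" "(t, k) \<notin> J"
    and W: "W \<in> borel_measurable (hist J)" and W2: "l2_bound M W c"
  shows "(\<integral>\<omega>. W \<omega> \<bullet> noise t k \<omega> \<partial>M) = 0"
proof -
  have tk: "t < T" "k \<in> {1..K}" using J(3) by (auto simp: samples_def)
  interpret D: prob_space \<D>
    using prob_space_distr[OF sample(1)[OF tk]] sample(2)[OF tk] by simp
  note [measurable] = half_hist_measurable[OF J(1,2) tk(2)]
  let ?h = "\<lambda>\<omega> s. grad_f (half t k \<omega>) s - grad_F (half t k \<omega>)"
  have "(\<lambda>z. grad_f (half t k (fst z)) (snd z)) \<in> borel_measurable (hist J \<Otimes>\<^sub>M \<D>)"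
    by (rule grad_f_comp_measurable) measurable
  then have h: "(\<lambda>(\<omega>, s). ?h \<omega> s) \<in> borel_measurable (hist J \<Otimes>\<^sub>M \<D>)"
    unfolding case_prod_beta by measurable
  have "(\<integral>\<omega>. W \<omega> \<bullet> ?h \<omega> (\<xi> t k \<omega>) \<partial>M) = 0"
  proof (rule expectation_inner_indep_eq_0[OF subalgebra_hist[OF J(1)] sample(1)[OF tk] _ W h])
    show "prob (A \<inter> (\<xi> t k -` S \<inter> space M)) = prob A * prob (\<xi> t k -` S \<inter> space M)"
      if "A \<in> sets (hist J)" "S \<in> sets \<D>" for A S
      using prob_hist_sample J that by blast
    show "integrable (distr M \<D> (\<xi> t k)) (?h \<omega>)" "(\<integral>s. ?h \<omega> s \<partial>distr M \<D> (\<xi> t k)) = 0" for \<omega>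
      unfolding sample(2)[OF tk] using unbiased[of "half t k \<omega>"] by (simp_all add: D.prob_space)
    show "integrable M (\<lambda>\<omega>. W \<omega> \<bullet> ?h \<omega> (\<xi> t k \<omega>))"
      using integrable_inner_l2[OF W2 l2_bound_noise[OF tk]] by (simp add: noise_def sgrad_def)
  qed
  then show ?thesis by (simp add: noise_def sgrad_def)
qed

lemma l2_bound_grad_half:
  assumes "t < T" "k \<in> {1..K}"
  shows "l2_bound M (\<lambda>\<omega>. grad_F (half t k \<omega>)) \<bar>B\<bar>"
  using assms run_measurable(5)[of t k] bounded(2)[of t k]
  by (intro l2_bound_AE_bounded measurable_compose[OF _ grad_F_measurable]) auto

lemma l2_bound_grad_iterate:
  assumes "t < T"
  shows "l2_bound M (\<lambda>\<omega>. grad_F (iterate t \<omega>)) \<bar>B\<bar>"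
  using assms run_measurable(1)[of t] bounded(1)[of t]
  by (intro l2_bound_AE_bounded measurable_compose[OF _ grad_F_measurable]) auto

text \<open>The cross term of gradient and noise vanishes, since the half step is determined by the
  past. Hence the second moments add without a factor 2.\<close>

lemma l2_bound_sgrad:
  assumes tk: "t < T" "k \<in> {1..K}"
  shows "l2_bound M (sgrad t k) G"
proof -
  let ?g = "\<lambda>\<omega>. grad_F (half t k \<omega>)"
  note n = l2_bound_noise[OF tk] and g = l2_bound_grad_half[OF tk]
  let ?J = "{..<t} \<times> {1..K}"
  have J: "?J \<subseteq> samples" "(t, k) \<in> samples" "(t, k) \<notin> ?J" using tk by (auto simp: samples_def)
  have "?g \<in> borel_measurable (hist ?J)"
    by (rule measurable_compose[OF half_hist_measurable[OF J(1) subset_refl tk(2)] grad_F_measurable])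
  then have orth: "(\<integral>\<omega>. ?g \<omega> \<bullet> noise t k \<omega> \<partial>M) = 0"
    using noise_orthogonal[OF J(1) subset_refl J(2,3)] g by blast
  have eq: "(norm (sgrad t k \<omega>))\<^sup>2
      = (norm (noise t k \<omega>))\<^sup>2 + 2 * (?g \<omega> \<bullet> noise t k \<omega>) + (norm (?g \<omega>))\<^sup>2" for \<omega>
  proof -
    have "sgrad t k \<omega> = ?g \<omega> + noise t k \<omega>" by (simp add: noise_def)
    then show ?thesis
      by (simp only: power2_norm_eq_inner inner_add_left inner_add_right)
        (simp add: inner_commute)
  qed
  note ints = l2_boundD(2)[OF n] l2_boundD(2)[OF g] integrable_inner_l2[OF g n]
  have "(\<integral>\<omega>. (norm (sgrad t k \<omega>))\<^sup>2 \<partial>M) \<le> \<sigma>\<^sup>2 + B\<^sup>2"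
    unfolding eq using ints orth l2_boundD(3)[OF n] l2_boundD(3)[OF g] by simp
  moreover have "integrable M (\<lambda>\<omega>. (norm (sgrad t k \<omega>))\<^sup>2)"
    unfolding eq using ints by simp
  ultimately show ?thesis
    using stochastic_measurable(1)[OF tk] by (simp add: l2_bound_def add.commute)
qed

text \<open>Conditional on the error bound, so that it can be used inside the induction for
  \<open>l2_bound_err\<close>, after which the condition is discharged.\<close>

lemma l2_bound_corrected_if:
  assumes tk: "t < T" "k \<in> {1..K}" and e: "l2_bound M (err t k) (s / (1 - s) * (\<eta> * G))"
  shows "l2_bound M (corrected t k) (\<eta> * G / (1 - s))"
proof -
  have "l2_bound M (\<lambda>\<omega>. err t k \<omega> + \<eta>s t *\<^sub>R sgrad t k \<omega>) (s / (1 - s) * (\<eta> * G) + \<eta> * G)"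
    using l2_bound_scaleR[OF l2_bound_sgrad[OF tk], of "\<eta>s t"] s_range step_size(1)[OF tk(1)] step_size(2)
    by (intro l2_bound_add e) auto
  then show ?thesis
    unfolding geometric_step[OF s_range(2)] corrected_def[abs_def] .
qed

text \<open>The errors start at zero and thus stay below the fixed point of
  \<open>y \<mapsto> s * (y + \<eta> * G)\<close>, uniformly in \<open>t\<close>.\<close>

lemma l2_bound_err:
  assumes "t \<le> T" "k \<in> {1..K}"
  shows "l2_bound M (err t k) (s / (1 - s) * (\<eta> * G))"
  using assms(1)
proof (induction t)
  case 0
  have "err 0 k = (\<lambda>_. 0)" by auto
  then show ?case by (simp add: l2_bound_def)
next
  case (Suc t)
  then have c: "l2_bound M (corrected t k) (\<eta> * G / (1 - s))"
    using l2_bound_corrected_if[of t k] assms(2) by simp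
  have "l2_bound M (err (Suc t) k) (s * (\<eta> * G / (1 - s)))"
    using run_measurable(2)[OF Suc.prems assms(2)] compression_error
    by (intro l2_bound_dominated[OF c]) (auto simp: run_Suc)
  then show ?case by simp
qed

lemmas l2_bound_corrected = l2_bound_corrected_if[OF _ _ l2_bound_err[OF less_imp_le]]

lemma l2_bound_compressed:
  assumes "t < T" "k \<in> {1..K}"
  shows "l2_bound M (\<lambda>\<omega>. \<C> (corrected t k \<omega>)) ((1 + s) * (\<eta> * G / (1 - s)))"
proof -
  have c: "l2_bound M (corrected t k) (\<eta> * G / (1 - s))"
    using l2_bound_corrected assms by blast
  show ?thesis
    using norm_compressed
    by (intro l2_bound_dominated[OF c] measurable_compose[OF l2_boundD(1)[OF c] \<C>_measurable]) auto
qed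

text \<open>The same recursion as for the local errors, now driven by the mean of the compressed
  vectors. Compression may enlarge a vector by the factor \<open>1 + s\<close>, which explains the
  numerator.\<close>

lemma l2_bound_srv_err:
  assumes "t \<le> T"
  shows "l2_bound M (srv_err t) (s / (1 - s) * ((1 + s) / (1 - s) * (\<eta> * G)))"
  using assms
proof (induction t)
  case 0
  have "srv_err 0 = (\<lambda>_. 0)" by auto
  then show ?case by (simp add: l2_bound_def)
next
  case (Suc t)
  let ?X = "(1 + s) * (\<eta> * G / (1 - s))"
  have X: "0 \<le> ?X" using s_range step_size(2) by simp
  have m: "l2_bound M (\<lambda>\<omega>. mean K (\<lambda>k. \<C> (corrected t k \<omega>))) ?X"
    using Suc.prems by (intro l2_bound_mean[OF K _ X] l2_bound_compressed) auto
  have agg: "l2_bound M (aggregated t) (s / (1 - s) * ?X + ?X)"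
    using l2_bound_add[OF Suc.IH m] Suc.prems s_range step_size(2) X
    by (simp add: aggregated_def[abs_def])
  have "l2_bound M (srv_err (Suc t)) (s * (s / (1 - s) * ?X + ?X))"
    using run_measurable(3)[OF Suc.prems] compression_error
    by (intro l2_bound_dominated[OF agg]) (auto simp: run_Suc)
  moreover have "s * (s / (1 - s) * ?X + ?X) = s / (1 - s) * ((1 + s) / (1 - s) * (\<eta> * G))"
    unfolding geometric_step[OF s_range(2)] by simp
  ultimately show ?case by simp
qed

text \<open>The local errors appear twice: once in the distance to the half steps and once in the
  distance to the virtual iterate. The server error appears only in the latter.\<close>

definition gap :: "nat \<Rightarrow> 'w \<Rightarrow> real" where
  "gap t \<omega> = 2 * mean K (\<lambda>k. norm (err t k \<omega>)) + norm (srv_err t \<omega>)"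

lemma l2_bound_gap:
  assumes "t < T"
  shows "l2_bound M (gap t) ((3 - s) / (1 - s) * (s / (1 - s) * (\<eta> * G)))"
proof -
  have X: "0 \<le> s / (1 - s) * (\<eta> * G)" using s_range step_size(2) by simp
  have "l2_bound M (\<lambda>\<omega>. mean K (\<lambda>k. norm (err t k \<omega>))) (s / (1 - s) * (\<eta> * G))"
    using assms by (intro l2_bound_mean[OF K _ X] l2_bound_norm l2_bound_err) auto
  from l2_bound_scaleR[OF this, of 2]
  have "l2_bound M (\<lambda>\<omega>. 2 * mean K (\<lambda>k. norm (err t k \<omega>)) + norm (srv_err t \<omega>))
      (2 * (s / (1 - s) * (\<eta> * G)) + s / (1 - s) * ((1 + s) / (1 - s) * (\<eta> * G)))"
    using assms s_range step_size(2) X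
    by (intro l2_bound_add l2_bound_norm l2_bound_srv_err) auto
  moreover have "2 * (s / (1 - s) * (\<eta> * G)) + s / (1 - s) * ((1 + s) / (1 - s) * (\<eta> * G))
      = (2 + (1 + s) / (1 - s)) * (s / (1 - s) * (\<eta> * G))"
    by (simp only: distrib_right mult.left_commute[of "s / (1 - s)"])
  moreover have "2 + (1 + s) / (1 - s) = (3 - s) / (1 - s)"
    using s_range by (simp add: field_simps)
  ultimately show ?thesis by (simp add: gap_def[abs_def])
qed

text \<open>In the double sum over pairs of workers only the diagonal survives, leaving
  \<open>K\<close> of \<open>K * K\<close> terms. The triangle inequality alone would give
  \<open>\<sigma>\<close> without the gain from averaging.\<close>

lemma mean_noise:
  assumes "t < T"
  shows "l2_bound M (\<lambda>\<omega>. mean K (\<lambda>k. noise t k \<omega>)) (\<sigma> / sqrt (real K))"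
proof -
  have n: "l2_bound M (noise t k) \<sigma>" if "k \<in> {1..K}" for k
    using l2_bound_noise assms that by blast
  have orth: "(\<integral>\<omega>. noise t k \<omega> \<bullet> noise t l \<omega> \<partial>M) = 0" if kl: "k \<in> {1..K}" "l \<in> {1..K}" "k \<noteq> l" for k l
  proof (rule noise_orthogonal)
    \<comment> \<open>All samples but \<open>(t, l)\<close>: the set must contain the sample of
      worker \<open>k\<close> from the same iteration, on which \<open>noise t k\<close>
      depends.\<close>
    show "samples - {(t, l)} \<subseteq> samples" "{..<t} \<times> {1..K} \<subseteq> samples - {(t, l)}"
      "(t, l) \<in> samples" "(t, l) \<notin> samples - {(t, l)}"
      using kl assms by (auto simp: samples_def)
    show "noise t k \<in> borel_measurable (hist (samples - {(t, l)}))"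
      using kl assms by (intro noise_hist_measurable) (auto simp: samples_def)
    show "l2_bound M (noise t k) \<sigma>" using n kl by blast
  qed
  have eq: "(norm (mean K (\<lambda>k. noise t k \<omega>)))\<^sup>2
      = (1 / real K)\<^sup>2 * (\<Sum>k = 1..K. \<Sum>l = 1..K. noise t k \<omega> \<bullet> noise t l \<omega>)" for \<omega>
    unfolding power2_norm_eq_inner inner_scaleR_left inner_scaleR_right inner_sum_left
    by (simp add: inner_sum_right power2_eq_square)
  have int: "integrable M (\<lambda>\<omega>. noise t k \<omega> \<bullet> noise t l \<omega>)" if "k \<in> {1..K}" "l \<in> {1..K}" for k l
    using integrable_inner_l2 n that by blast
  have i2: "integrable M (\<lambda>\<omega>. (norm (mean K (\<lambda>k. noise t k \<omega>)))\<^sup>2)"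
    unfolding eq using int by (intro integrable_mult_right Bochner_Integration.integrable_sum) auto
  have "(\<integral>\<omega>. (norm (mean K (\<lambda>k. noise t k \<omega>)))\<^sup>2 \<partial>M)
      = (1 / real K)\<^sup>2 * (\<Sum>k = 1..K. \<Sum>l = 1..K. \<integral>\<omega>. noise t k \<omega> \<bullet> noise t l \<omega> \<partial>M)"
  proof -
    have "(\<integral>\<omega>. (\<Sum>k = 1..K. \<Sum>l = 1..K. noise t k \<omega> \<bullet> noise t l \<omega>) \<partial>M)
        = (\<Sum>k = 1..K. \<integral>\<omega>. (\<Sum>l = 1..K. noise t k \<omega> \<bullet> noise t l \<omega>) \<partial>M)"
      using int by (intro Bochner_Integration.integral_sum Bochner_Integration.integrable_sum) auto
    also have "\<dots> = (\<Sum>k = 1..K. \<Sum>l = 1..K. \<integral>\<omega>. noise t k \<omega> \<bullet> noise t l \<omega> \<partial>M)"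
      using int by (intro sum.cong refl Bochner_Integration.integral_sum) auto
    finally show ?thesis unfolding eq by simp
  qed
  also have "(\<Sum>k = 1..K. \<Sum>l = 1..K. \<integral>\<omega>. noise t k \<omega> \<bullet> noise t l \<omega> \<partial>M)
      = (\<Sum>k = 1..K. \<Sum>l = 1..K. if l = k then \<integral>\<omega>. (norm (noise t k \<omega>))\<^sup>2 \<partial>M else 0)"
    using orth by (intro sum.cong refl) (auto simp: power2_norm_eq_inner)
  also have "\<dots> = (\<Sum>k = 1..K. \<integral>\<omega>. (norm (noise t k \<omega>))\<^sup>2 \<partial>M)"
    by (intro sum.cong refl) simp
  also have "\<dots> \<le> (\<Sum>k = 1..K. \<sigma>\<^sup>2)"
    using l2_boundD(3)[OF n] by (intro sum_mono) auto
  also have "(1 / real K)\<^sup>2 * \<dots> = (\<sigma> / sqrt (real K))\<^sup>2"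
    using K by (simp add: power_divide) (simp add: power2_eq_square)
  finally have "(\<integral>\<omega>. (norm (mean K (\<lambda>k. noise t k \<omega>)))\<^sup>2 \<partial>M) \<le> (\<sigma> / sqrt (real K))\<^sup>2"
    by (simp add: mult_left_mono)
  moreover have "(\<lambda>\<omega>. mean K (\<lambda>k. noise t k \<omega>)) \<in> borel_measurable M"
    using l2_boundD(1)[OF n] by measurable
  ultimately show ?thesis using i2 by (simp add: l2_bound_def)
qed

subsection \<open>Descent along the virtual iterates\<close>

definition mean_grad :: "nat \<Rightarrow> 'w \<Rightarrow> 'a" where
  "mean_grad t \<omega> = mean K (\<lambda>k. grad_F (half t k \<omega>))"

text \<open>The vector that multiplies the mean noise linearly when the descent lemma is expanded.
  It is determined by the samples before iteration \<open>t\<close>.\<close>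

definition weight :: "nat \<Rightarrow> 'w \<Rightarrow> 'a" where
  "weight t \<omega> = (L * \<eta>\<^sup>2) *\<^sub>R mean_grad t \<omega> - \<eta> *\<^sub>R grad_F (virtual t \<omega>)"

lemma mean_grad_diff:
  "norm (mean_grad t \<omega> - grad_F (iterate t \<omega>)) \<le> L * mean K (\<lambda>k. norm (err t k \<omega>))"
proof -
  have "norm (mean_grad t \<omega> - grad_F (iterate t \<omega>)) \<le> mean K (\<lambda>k. L * norm (err t k \<omega>))"
    unfolding mean_grad_def
  proof (rule norm_mean_diff_le[OF K])
    fix k
    show "norm (grad_F (half t k \<omega>) - grad_F (iterate t \<omega>)) \<le> L * norm (err t k \<omega>)"
      using Lipschitz[of "half t k \<omega>" "iterate t \<omega>"] by (simp add: half_def)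
  qed
  then show ?thesis by (simp flip: sum_distrib_left)
qed

lemma virtual_grad_diff:
  "norm (grad_F (virtual t \<omega>) - grad_F (iterate t \<omega>))
    \<le> L * (norm (srv_err t \<omega>) + mean K (\<lambda>k. norm (err t k \<omega>)))"
proof -
  have "virtual t \<omega> - iterate t \<omega> = - (srv_err t \<omega> + mean K (\<lambda>k. err t k \<omega>))"
    by (simp add: virtual_def)
  then have "norm (virtual t \<omega> - iterate t \<omega>) = norm (srv_err t \<omega> + mean K (\<lambda>k. err t k \<omega>))"
    by (simp only: norm_minus_cancel)
  also have "\<dots> \<le> norm (srv_err t \<omega>) + mean K (\<lambda>k. norm (err t k \<omega>))"
    using norm_mean_diff_le[OF K, of "\<lambda>k. err t k \<omega>" 0 "\<lambda>k. norm (err t k \<omega>)"]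
    by (intro norm_triangle_le) simp
  finally show ?thesis
    using Lipschitz[of "virtual t \<omega>" "iterate t \<omega>"] L_pos by (meson mult_left_mono less_imp_le order_trans)
qed

lemma grad_diffs_le_gap:
  "norm (mean_grad t \<omega> - grad_F (iterate t \<omega>)) + norm (grad_F (virtual t \<omega>) - grad_F (iterate t \<omega>))
    \<le> L * gap t \<omega>"
proof -
  have "L * m + L * (a + m) = L * (2 * m + a)" for a m :: real by (simp add: algebra_simps)
  then show ?thesis
    unfolding gap_def using add_mono[OF mean_grad_diff[of t \<omega>] virtual_grad_diff[of t \<omega>]]
    by (simp only:)
qed

text \<open>The virtual increment is \<open>- \<eta>\<close> times mean gradient \<open>h\<close>
  plus mean noise \<open>n\<close>. Terms linear in \<open>n\<close> are collected in
  \<open>weight\<close>, and those without \<open>n\<close> are exactly what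
  \<open>virtual_descent_inequality\<close> bounds.\<close>

lemma descent_pathwise:
  assumes "t < T"
  shows "F (virtual (Suc t) \<omega>) \<le> F (virtual t \<omega>)
    - \<eta> * (3 - 2 * \<eta> * L) / 4 * (norm (grad_F (iterate t \<omega>)))\<^sup>2 + \<eta> * L\<^sup>2 * (gap t \<omega>)\<^sup>2
    + weight t \<omega> \<bullet> mean K (\<lambda>k. noise t k \<omega>) + L / 2 * \<eta>\<^sup>2 * (norm (mean K (\<lambda>k. noise t k \<omega>)))\<^sup>2"
proof -
  define n g h p where "n = mean K (\<lambda>k. noise t k \<omega>)" and "g = grad_F (iterate t \<omega>)"
    and "h = mean_grad t \<omega>" and "p = grad_F (virtual t \<omega>)"
  have "mean K (\<lambda>k. sgrad t k \<omega>) = h + n"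
    by (simp add: h_def n_def noise_def mean_grad_def sum_subtractf scaleR_diff_right)
  then have v: "virtual (Suc t) \<omega> = virtual t \<omega> + - (\<eta> *\<^sub>R (h + n))"
    using assms step_size(1) by (simp add: virtual_Suc)
  have "F (virtual (Suc t) \<omega>)
      \<le> F (virtual t \<omega>) + p \<bullet> (- (\<eta> *\<^sub>R (h + n))) + L / 2 * (norm (- (\<eta> *\<^sub>R (h + n))))\<^sup>2"
    unfolding v p_def by (rule descent_lemma[OF gradient Lipschitz])
  also have "p \<bullet> (- (\<eta> *\<^sub>R (h + n))) = - \<eta> * (p \<bullet> h) - \<eta> * (p \<bullet> n)"
    by (simp add: inner_add_right algebra_simps)
  also have "(norm (- (\<eta> *\<^sub>R (h + n))))\<^sup>2 = \<eta>\<^sup>2 * ((norm h)\<^sup>2 + 2 * (h \<bullet> n) + (norm n)\<^sup>2)"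
    by (simp add: power_mult_distrib power2_norm_eq_inner inner_add_left inner_add_right inner_commute)
  finally have "F (virtual (Suc t) \<omega>)
      \<le> F (virtual t \<omega>) + (- \<eta> * (p \<bullet> h) + L / 2 * \<eta>\<^sup>2 * (norm h)\<^sup>2)
        + (L * \<eta>\<^sup>2 * (h \<bullet> n) - \<eta> * (p \<bullet> n)) + L / 2 * \<eta>\<^sup>2 * (norm n)\<^sup>2"
    by (simp add: algebra_simps)
  moreover have "L * \<eta>\<^sup>2 * (h \<bullet> n) - \<eta> * (p \<bullet> n) = weight t \<omega> \<bullet> n"
    by (simp add: weight_def h_def p_def inner_diff_left)
  moreover have "- \<eta> * (p \<bullet> h) + L / 2 * \<eta>\<^sup>2 * (norm h)\<^sup>2
      \<le> - (\<eta> * (3 - 2 * \<eta> * L) / 4) * (norm g)\<^sup>2 + \<eta> * (norm (h - g) + norm (p - g))\<^sup>2"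
    using step_size(2) L_pos \<eta>L by (intro virtual_descent_inequality) auto
  moreover have "\<eta> * (norm (h - g) + norm (p - g))\<^sup>2 \<le> \<eta> * (L * gap t \<omega>)\<^sup>2"
    using step_size(2) grad_diffs_le_gap[of t \<omega>]
    by (intro mult_left_mono power_mono) (auto simp: h_def p_def g_def)
  ultimately show ?thesis
    unfolding n_def[symmetric] g_def[symmetric] by (simp add: power_mult_distrib algebra_simps)
qed

text \<open>Only square integrability matters, so the bound stays unspecified. The gradient at the
  virtual iterate is controlled by comparison with the bounded one at the iterate, at the price of
  \<open>L\<close> times \<open>gap\<close>.\<close>

lemma weight_l2:
  assumes "t < T"
  obtains c where "l2_bound M (weight t) c"
proof -
  have h: "l2_bound M (mean_grad t) \<bar>B\<bar>"
    unfolding mean_grad_def[abs_def] using assms by (intro l2_bound_mean[OF K] l2_bound_grad_half) auto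
  let ?d = "\<lambda>\<omega>. grad_F (virtual t \<omega>) - grad_F (iterate t \<omega>)"
  have X: "0 \<le> L * ((3 - s) / (1 - s) * (s / (1 - s) * (\<eta> * G)))"
  proof -
    have "0 \<le> 3 - s" "0 \<le> 1 - s" using s_range by linarith+
    then have "0 \<le> (3 - s) / (1 - s)" by (rule divide_nonneg_nonneg)
    moreover have "0 \<le> s / (1 - s) * (\<eta> * G)" using s_range step_size(2) by simp
    ultimately show ?thesis
      using L_pos by (meson mult_nonneg_nonneg less_imp_le)
  qed
  have [measurable]: "virtual t \<in> borel_measurable M" "iterate t \<in> borel_measurable M"
    using run_measurable assms by auto
  have "norm (?d \<omega>) \<le> L * norm (gap t \<omega>)" for \<omega>
    using grad_diffs_le_gap[of t \<omega>] L_pos norm_ge_zero[of "mean_grad t \<omega> - grad_F (iterate t \<omega>)"]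
      mult_left_mono[OF abs_ge_self[of "gap t \<omega>"], of L] unfolding real_norm_def by linarith
  then have d: "l2_bound M ?d (L * ((3 - s) / (1 - s) * (s / (1 - s) * (\<eta> * G))))"
    by (intro l2_bound_dominated[OF l2_bound_gap[OF assms]]) auto
  have "l2_bound M (\<lambda>\<omega>. grad_F (virtual t \<omega>)) (L * ((3 - s) / (1 - s) * (s / (1 - s) * (\<eta> * G))) + \<bar>B\<bar>)"
    using l2_bound_add[OF d l2_bound_grad_iterate[OF assms] X] by simp
  from l2_bound_scaleR[OF this, of "- \<eta>"]
  obtain c where c: "l2_bound M (\<lambda>\<omega>. - \<eta> *\<^sub>R grad_F (virtual t \<omega>)) c" by blast
  \<comment> \<open>\<open>l2_bound_add\<close> asks for nonnegative bounds, and changing the sign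
    of \<open>c\<close> is harmless.\<close>
  then have "l2_bound M (\<lambda>\<omega>. - \<eta> *\<^sub>R grad_F (virtual t \<omega>)) \<bar>c\<bar>" by (simp add: l2_bound_def)
  from l2_bound_add[OF l2_bound_scaleR[OF h, of "L * \<eta>\<^sup>2"] this]
  have "l2_bound M (weight t) (L * \<eta>\<^sup>2 * \<bar>B\<bar> + \<bar>c\<bar>)"
    using L_pos by (simp add: weight_def[abs_def])
  then show thesis by (rule that)
qed

lemma weight_noise:
  assumes "t < T"
  shows "integrable M (\<lambda>\<omega>. weight t \<omega> \<bullet> mean K (\<lambda>k. noise t k \<omega>))"
    and "(\<integral>\<omega>. weight t \<omega> \<bullet> mean K (\<lambda>k. noise t k \<omega>) \<partial>M) = 0"
proof -
  obtain c where c: "l2_bound M (weight t) c" using weight_l2[OF assms] .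
  show "integrable M (\<lambda>\<omega>. weight t \<omega> \<bullet> mean K (\<lambda>k. noise t k \<omega>))"
    by (rule integrable_inner_l2[OF c mean_noise[OF assms]])
  let ?J = "{..<t} \<times> {1..K}"
  have J: "?J \<subseteq> samples" using assms by (auto simp: samples_def)
  have [measurable]: "half t k \<in> borel_measurable (hist ?J)" if "k \<in> {1..K}" for k
    by (rule half_hist_measurable[OF J subset_refl that])
  note [measurable] = virtual_hist_measurable[OF J subset_refl]
  have "(\<lambda>\<omega>. grad_F (half t k \<omega>)) \<in> borel_measurable (hist ?J)" if "k \<in> {1..K}" for k
    by (rule measurable_compose[OF half_hist_measurable[OF J subset_refl that] grad_F_measurable])
  then have [measurable]: "mean_grad t \<in> borel_measurable (hist ?J)"
    unfolding mean_grad_def[abs_def]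
    by (intro borel_measurable_scaleR borel_measurable_const borel_measurable_sum) auto
  have w: "weight t \<in> borel_measurable (hist ?J)"
    unfolding weight_def[abs_def] by measurable
  have "(\<integral>\<omega>. weight t \<omega> \<bullet> noise t k \<omega> \<partial>M) = 0" if "k \<in> {1..K}" for k
    using that assms by (intro noise_orthogonal[OF J subset_refl _ _ w c]) (auto simp: samples_def)
  moreover have "integrable M (\<lambda>\<omega>. weight t \<omega> \<bullet> noise t k \<omega>)" if "k \<in> {1..K}" for k
    using integrable_inner_l2[OF c l2_bound_noise] assms that by blast
  ultimately have "(\<integral>\<omega>. (\<Sum>k = 1..K. weight t \<omega> \<bullet> noise t k \<omega>) \<partial>M) = 0"
    by (subst Bochner_Integration.integral_sum) auto
  then show "(\<integral>\<omega>. weight t \<omega> \<bullet> mean K (\<lambda>k. noise t k \<omega>) \<partial>M) = 0"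
    by (simp add: inner_sum_right)
qed

section \<open>Expected descent, telescoping and the final constants\<close>

definition penalty :: real where
  "penalty = \<eta> * L\<^sup>2 * ((3 - s) / (1 - s) * (s / (1 - s) * (\<eta> * G)))\<^sup>2 + L / 2 * \<eta>\<^sup>2 * (\<sigma> / sqrt (real K))\<^sup>2"

text \<open>Integrability of \<open>F\<close> along the virtual iterates is carried from one
  iteration to the next: the new value lies between the constant \<open>F xstar\<close> and the
  integrable pathwise upper bound.\<close>

lemma expected_descent:
  assumes t: "t < T" and int: "integrable M (\<lambda>\<omega>. F (virtual t \<omega>))"
  shows "integrable M (\<lambda>\<omega>. F (virtual (Suc t) \<omega>))"
    and "\<eta> * (3 - 2 * \<eta> * L) / 4 * (\<integral>\<omega>. (norm (grad_F (iterate t \<omega>)))\<^sup>2 \<partial>M)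
      \<le> (\<integral>\<omega>. F (virtual t \<omega>) \<partial>M) - (\<integral>\<omega>. F (virtual (Suc t) \<omega>) \<partial>M) + penalty"
proof -
  let ?q = "\<eta> * (3 - 2 * \<eta> * L) / 4"
  let ?U = "\<lambda>\<omega>. F (virtual t \<omega>)
    - ?q * (norm (grad_F (iterate t \<omega>)))\<^sup>2 + \<eta> * L\<^sup>2 * (gap t \<omega>)\<^sup>2
    + weight t \<omega> \<bullet> mean K (\<lambda>k. noise t k \<omega>) + L / 2 * \<eta>\<^sup>2 * (norm (mean K (\<lambda>k. noise t k \<omega>)))\<^sup>2"
  have gap: "integrable M (\<lambda>\<omega>. (gap t \<omega>)\<^sup>2)"
    "(\<integral>\<omega>. (gap t \<omega>)\<^sup>2 \<partial>M) \<le> ((3 - s) / (1 - s) * (s / (1 - s) * (\<eta> * G)))\<^sup>2"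
    using l2_boundD(2,3)[OF l2_bound_gap[OF t]] by simp_all
  note n = l2_boundD(2,3)[OF mean_noise[OF t]]
  note ints = int l2_boundD(2)[OF l2_bound_grad_iterate[OF t]] gap(1) weight_noise(1)[OF t] n(1)
  have iU: "integrable M ?U"
    by (intro Bochner_Integration.integrable_add Bochner_Integration.integrable_diff
        integrable_mult_right ints)
  have [measurable]: "virtual (Suc t) \<in> borel_measurable M"
    using run_measurable(4) t by simp
  show i: "integrable M (\<lambda>\<omega>. F (virtual (Suc t) \<omega>))"
  proof (rule Bochner_Integration.integrable_bound)
    show "integrable M (\<lambda>\<omega>. \<bar>?U \<omega>\<bar> + \<bar>F xstar\<bar>)"
      by (intro Bochner_Integration.integrable_add integrable_abs iU) simp
    have "\<bar>F (virtual (Suc t) \<omega>)\<bar> \<le> \<bar>?U \<omega>\<bar> + \<bar>F xstar\<bar>" for \<omega>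
      using descent_pathwise[OF t, of \<omega>] minimizer[of "virtual (Suc t) \<omega>"] by linarith
    then show "AE \<omega> in M. norm (F (virtual (Suc t) \<omega>)) \<le> norm (\<bar>?U \<omega>\<bar> + \<bar>F xstar\<bar>)"
      by (intro AE_I2) (simp only: real_norm_def abs_of_nonneg abs_ge_zero add_nonneg_nonneg)
  qed measurable
  have "(\<integral>\<omega>. F (virtual (Suc t) \<omega>) \<partial>M) \<le> (\<integral>\<omega>. ?U \<omega> \<partial>M)"
    by (rule integral_mono[OF i iU descent_pathwise[OF t]])
  also have "\<dots> = (\<integral>\<omega>. F (virtual t \<omega>) \<partial>M) - ?q * (\<integral>\<omega>. (norm (grad_F (iterate t \<omega>)))\<^sup>2 \<partial>M)
      + \<eta> * L\<^sup>2 * (\<integral>\<omega>. (gap t \<omega>)\<^sup>2 \<partial>M) + (\<integral>\<omega>. weight t \<omega> \<bullet> mean K (\<lambda>k. noise t k \<omega>) \<partial>M)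
      + L / 2 * \<eta>\<^sup>2 * (\<integral>\<omega>. (norm (mean K (\<lambda>k. noise t k \<omega>)))\<^sup>2 \<partial>M)"
    using ints by (simp only: Bochner_Integration.integral_add Bochner_Integration.integral_diff
        Bochner_Integration.integrable_add Bochner_Integration.integrable_diff
        integrable_mult_right integral_mult_right_zero simp_thms)
  also have "\<dots> \<le> (\<integral>\<omega>. F (virtual t \<omega>) \<partial>M) - ?q * (\<integral>\<omega>. (norm (grad_F (iterate t \<omega>)))\<^sup>2 \<partial>M) + penalty"
  proof -
    have "\<eta> * L\<^sup>2 * (\<integral>\<omega>. (gap t \<omega>)\<^sup>2 \<partial>M)
        \<le> \<eta> * L\<^sup>2 * ((3 - s) / (1 - s) * (s / (1 - s) * (\<eta> * G)))\<^sup>2"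
      using gap(2) step_size(2) by (intro mult_left_mono) auto
    moreover have "L / 2 * \<eta>\<^sup>2 * (\<integral>\<omega>. (norm (mean K (\<lambda>k. noise t k \<omega>)))\<^sup>2 \<partial>M)
        \<le> L / 2 * \<eta>\<^sup>2 * (\<sigma> / sqrt (real K))\<^sup>2"
      using n(2) L_pos by (intro mult_left_mono) auto
    ultimately show ?thesis
      unfolding penalty_def weight_noise(2)[OF t] by linarith
  qed
  finally show "?q * (\<integral>\<omega>. (norm (grad_F (iterate t \<omega>)))\<^sup>2 \<partial>M)
      \<le> (\<integral>\<omega>. F (virtual t \<omega>) \<partial>M) - (\<integral>\<omega>. F (virtual (Suc t) \<omega>) \<partial>M) + penalty"
    by linarith
qed

lemma sum_grad_le:
  "\<eta> * (3 - 2 * \<eta> * L) / 4 * (\<Sum>t<T. \<integral>\<omega>. (norm (grad_F (iterate t \<omega>)))\<^sup>2 \<partial>M)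
    \<le> F x0 - F xstar + real T * penalty"
proof -
  let ?q = "\<eta> * (3 - 2 * \<eta> * L) / 4"
  have "integrable M (\<lambda>\<omega>. F (virtual n \<omega>)) \<and>
    ?q * (\<Sum>t<n. \<integral>\<omega>. (norm (grad_F (iterate t \<omega>)))\<^sup>2 \<partial>M)
      \<le> F x0 - (\<integral>\<omega>. F (virtual n \<omega>) \<partial>M) + real n * penalty" if "n \<le> T" for n
    using that
  proof (induction n)
    case 0
    \<comment> \<open>All initial errors vanish, so the virtual iterate starts at \<open>x0\<close>
      and the telescoping sum at \<open>F x0\<close>.\<close>
    then show ?case by (simp add: virtual_def prob_space)
  next
    case (Suc n)
    then have IH: "integrable M (\<lambda>\<omega>. F (virtual n \<omega>))"
      "?q * (\<Sum>t<n. \<integral>\<omega>. (norm (grad_F (iterate t \<omega>)))\<^sup>2 \<partial>M)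
        \<le> F x0 - (\<integral>\<omega>. F (virtual n \<omega>) \<partial>M) + real n * penalty" by auto
    have "n < T" using Suc.prems by simp
    note step = expected_descent[OF this IH(1)]
    have "?q * (\<Sum>t<Suc n. \<integral>\<omega>. (norm (grad_F (iterate t \<omega>)))\<^sup>2 \<partial>M)
      = ?q * (\<Sum>t<n. \<integral>\<omega>. (norm (grad_F (iterate t \<omega>)))\<^sup>2 \<partial>M)
        + ?q * (\<integral>\<omega>. (norm (grad_F (iterate n \<omega>)))\<^sup>2 \<partial>M)"
      by (simp only: sum.lessThan_Suc distrib_left)
    also have "\<dots> \<le> F x0 - (\<integral>\<omega>. F (virtual (Suc n) \<omega>) \<partial>M) + real (Suc n) * penalty"
      using IH(2) step(2) by (simp add: algebra_simps)
    finally show ?case using step(1) by simp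
  qed
  from this[OF order_refl] have i: "integrable M (\<lambda>\<omega>. F (virtual T \<omega>))"
    and le: "?q * (\<Sum>t<T. \<integral>\<omega>. (norm (grad_F (iterate t \<omega>)))\<^sup>2 \<partial>M)
      \<le> F x0 - (\<integral>\<omega>. F (virtual T \<omega>) \<partial>M) + real T * penalty" by auto
  have "F xstar \<le> (\<integral>\<omega>. F (virtual T \<omega>) \<partial>M)"
    using integral_mono[OF _ i, of "\<lambda>_. F xstar"] minimizer by (simp add: prob_space)
  then show ?thesis using le by linarith
qed

text \<open>The minimum is at most the average, so dividing the summed inequality by
  \<open>\<eta> * (3 - 2 * \<eta> * L) / 4 * T\<close> gives the claim up to constants.\<close>

lemma min_grad_le:
  defines "C \<equiv> 2 * (1 + \<delta>) * (2 - \<delta>) / (1 - s)\<^sup>2 + (1 + \<delta>) / \<delta>"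
  shows "(MIN t\<in>{..<T}. \<integral>\<omega>. (norm (grad_F (iterate t \<omega>)))\<^sup>2 \<partial>M)
    \<le> 4 * (F x0 - F xstar) / (\<eta> * (3 - 2 * \<eta> * L) * real T)
      + 4 * \<eta> * L * \<sigma>\<^sup>2 / ((3 - 2 * \<eta> * L) * real K)
      + (2 + 8 * C / (3 - 2 * \<eta> * L)) * ((1 - \<delta>) / (1 - s)\<^sup>2) * \<eta>\<^sup>2 * L\<^sup>2 * (B\<^sup>2 + \<sigma>\<^sup>2)"
proof -
  define c A where "c = 3 - 2 * \<eta> * L" and "A = (1 - \<delta>) / (1 - s)\<^sup>2 * \<eta>\<^sup>2 * L\<^sup>2 * (B\<^sup>2 + \<sigma>\<^sup>2)"
  define Q where "Q = ((3 - s) / (1 - s))\<^sup>2"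
  let ?E = "\<lambda>t. \<integral>\<omega>. (norm (grad_F (iterate t \<omega>)))\<^sup>2 \<partial>M"
  let ?m = "MIN t\<in>{..<T}. ?E t"
  have c: "0 < c" using \<eta>L by (simp add: c_def)
  have A: "0 \<le> A" using \<delta> by (simp add: A_def)
  have QC: "Q \<le> 2 * C"
    unfolding Q_def C_def by (rule server_constant_le[OF \<delta>])
  have s2: "s\<^sup>2 = 1 - \<delta>" "G\<^sup>2 = B\<^sup>2 + \<sigma>\<^sup>2" using \<delta> by auto
  have pen: "penalty = \<eta> * (Q * A) + L / 2 * \<eta>\<^sup>2 * (\<sigma>\<^sup>2 / real K)"
    unfolding penalty_def Q_def A_def
    by (simp only: power_mult_distrib power_divide s2 real_sqrt_pow2 of_nat_0_le_iff)
      (simp add: mult_ac)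
  have "real T * ?m = (\<Sum>t<T. ?m)" by simp
  also have "\<dots> \<le> (\<Sum>t<T. ?E t)"
    by (intro sum_mono Min_le) auto
  finally have "\<eta> * c / 4 * (real T * ?m) \<le> \<eta> * c / 4 * (\<Sum>t<T. ?E t)"
    using c step_size(2) by (intro mult_left_mono) auto
  also have "\<dots> \<le> F x0 - F xstar + real T * penalty"
    using sum_grad_le by (simp add: c_def)
  finally have "?m \<le> (F x0 - F xstar + real T * penalty) / (\<eta> * c / 4 * real T)"
    using c step_size(2) T by (simp add: pos_le_divide_eq mult_ac)
  also have "\<dots> = 4 * (F x0 - F xstar) / (\<eta> * c * real T) + 2 * \<eta> * L * \<sigma>\<^sup>2 / (c * real K) + 4 * Q / c * A"
    using c step_size(2) T K unfolding pen by (simp add: field_simps power2_eq_square)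
  also have "\<dots> \<le> 4 * (F x0 - F xstar) / (\<eta> * c * real T) + 4 * \<eta> * L * \<sigma>\<^sup>2 / (c * real K)
      + (2 + 8 * C / c) * A"
  \<comment> \<open>Here the estimate is relaxed to the stated form: the noise term is doubled,
    \<open>4 * Q\<close> becomes \<open>8 * C\<close> by \<open>QC\<close>, and the summand
    \<open>2 * A\<close> is added.\<close>
  proof (intro add_mono order_refl divide_right_mono mult_right_mono A)
    show "4 * Q / c \<le> 2 + 8 * C / c" using QC c by (simp add: field_simps)
  qed (use c step_size(2) L_pos in auto)
  finally show ?thesis by (simp add: c_def A_def mult.assoc)
qed

end

theorem theorem2:
  fixes \<P> :: "'w measure" and \<D> :: "'s measure"
    and f :: "'a::euclidean_space \<Rightarrow> 's \<Rightarrow> real" and grad_f :: "'a \<Rightarrow> 's \<Rightarrow> 'a"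
    and F :: "'a \<Rightarrow> real" and grad_F :: "'a \<Rightarrow> 'a"
    and \<C> :: "'a \<Rightarrow> 'a" and \<xi> :: "nat \<Rightarrow> nat \<Rightarrow> 'w \<Rightarrow> 's"
    and x0 xstar :: 'a and T K k :: nat and \<eta>s :: "nat \<Rightarrow> real"
    and \<eta> L \<sigma> M \<delta> C :: real
    and state :: "nat \<Rightarrow> 'w \<Rightarrow> 'a saef_state"
    and X X_half :: "nat \<Rightarrow> nat \<Rightarrow> 'w \<Rightarrow> 'a"
  assumes "prob_space \<P>" and "prob_space \<D>" and "1 \<le> T" and "1 \<le> K"
    \<comment> \<open>the objective, its gradient, and the stochastic gradients\<close>
    and "\<And>x. integrable \<D> (f x)"
    and "\<And>x. F x = (\<integral>s. f x s \<partial>\<D>)"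
    and "\<And>x s. s \<in> space \<D> \<Longrightarrow> GDERIV (\<lambda>y. f y s) x :> grad_f x s"
    and "(\<lambda>(x, s). grad_f x s) \<in> borel_measurable (borel \<Otimes>\<^sub>M \<D>)"
    and "\<And>x. GDERIV F x :> grad_F x"
    and unbiased: "\<And>x. integrable \<D> (grad_f x)" "\<And>x. (\<integral>s. grad_f x s \<partial>\<D>) = grad_F x"
    and minimizer: "\<And>x. F xstar \<le> F x"
    \<comment> \<open>the samples are i.i.d. over iterations and workers, with law \<open>\<D>\<close>\<close>
    and "\<And>t k. t < T \<Longrightarrow> k \<in> {1..K} \<Longrightarrow> \<xi> t k \<in> measurable \<P> \<D> \<and> distr \<P> \<D> (\<xi> t k) = \<D>"
    and "prob_space.indep_vars \<P> (\<lambda>_. \<D>) (\<lambda>(t, k). \<xi> t k) ({..<T} \<times> {1..K})"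
    \<comment> \<open>the iterates\<close>
    and "\<And>t \<omega>. state t \<omega> = saef \<C> K \<eta>s x0 (\<lambda>t k x. grad_f x (\<xi> t k \<omega>)) t"
    and "\<And>t k \<omega>. X t k \<omega> = model (state t \<omega>) k"
    and "\<And>t k \<omega>. X_half t k \<omega> = half_step (state t \<omega>) k"
    and A1: "\<And>x y. norm (grad_F x - grad_F y) \<le> L * norm (x - y)"
    and A2: "\<And>t k Y. t < T \<Longrightarrow> k \<in> {1..K} \<Longrightarrow> Y \<in> {X t k, X_half t k} \<Longrightarrow>
        integrable \<P> (\<lambda>\<omega>. (norm (grad_f (Y \<omega>) (\<xi> t k \<omega>) - grad_F (Y \<omega>)))\<^sup>2) \<and>
        (\<integral>\<omega>. (norm (grad_f (Y \<omega>) (\<xi> t k \<omega>) - grad_F (Y \<omega>)))\<^sup>2 \<partial>\<P>) \<le> \<sigma>\<^sup>2"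
    and A3: "\<And>t k Y. t < T \<Longrightarrow> k \<in> {1..K} \<Longrightarrow> Y \<in> {X t k, X_half t k} \<Longrightarrow>
        AE \<omega> in \<P>. (norm (grad_F (Y \<omega>)))\<^sup>2 \<le> M\<^sup>2"
    and A4: "0 < \<delta>" "\<delta> \<le> 1" "\<And>v. (norm (\<C> v - v))\<^sup>2 \<le> (1 - \<delta>) * (norm v)\<^sup>2"
    and "\<C> \<in> borel_measurable borel"
    and step_size: "\<And>t. t < T \<Longrightarrow> \<eta>s t = \<eta>" "0 < \<eta>" "\<eta> < 3 / (2 * L)"
    and C: "C = 2 * (1 + \<delta>) * (2 - \<delta>) / (1 - sqrt (1 - \<delta>))\<^sup>2 + (1 + \<delta>) / \<delta>"
    and "k \<in> {1..K}"
  shows "(MIN t\<in>{..<T}. \<integral>\<omega>. (norm (grad_F (X t k \<omega>)))\<^sup>2 \<partial>\<P>)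
    \<le> 4 * (F x0 - F xstar) / (\<eta> * (3 - 2 * \<eta> * L) * real T)
      + 4 * \<eta> * L * \<sigma>\<^sup>2 / ((3 - 2 * \<eta> * L) * real K)
      + (2 + 8 * C / (3 - 2 * \<eta> * L)) * ((1 - \<delta>) / (1 - sqrt (1 - \<delta>))\<^sup>2)
        * \<eta>\<^sup>2 * L\<^sup>2 * (M\<^sup>2 + \<sigma>\<^sup>2)"
proof -
  interpret P: prob_space \<P> by fact
  interpret saef_run grad_f \<C> \<xi> x0 K \<eta>s .
  have st: "state t \<omega> = saef_run.state grad_f \<C> \<xi> x0 K \<eta>s t \<omega>" for t \<omega>
    by (simp add: assms(15) state_def)
  have X: "X t k = iterate t" "X_half t k = half t k" for t k
    by (auto simp: assms(16,17) st model_state half_step_state)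
  interpret saef_sgd \<P> grad_f \<C> \<xi> x0 K \<eta>s \<D> F grad_F xstar T \<eta> L \<sigma> M \<delta>
  proof
    fix t k assume tk: "t < T" "k \<in> {1..K}"
    show "\<xi> t k \<in> \<P> \<rightarrow>\<^sub>M \<D>" "distr \<P> \<D> (\<xi> t k) = \<D>"
      using assms(13)[OF tk] by auto
    \<comment> \<open>The algorithm evaluates stochastic gradients at the half steps, so (A2) and
      (A3) are instantiated there.\<close>
    have "X_half t k \<in> {X t k, X_half t k}" by simp
    from A2[OF tk this] A3[OF tk this]
    show "integrable \<P> (\<lambda>\<omega>. (norm (sgrad t k \<omega> - grad_F (half t k \<omega>)))\<^sup>2)"
      "(\<integral>\<omega>. (norm (sgrad t k \<omega> - grad_F (half t k \<omega>)))\<^sup>2 \<partial>\<P>) \<le> \<sigma>\<^sup>2"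
      "AE \<omega> in \<P>. (norm (grad_F (half t k \<omega>)))\<^sup>2 \<le> M\<^sup>2"
      by (auto simp: X sgrad_def)
  next
    fix t assume "t < T"
    from A3[OF this \<open>k \<in> {1..K}\<close>, of "X t k"]
    show "AE \<omega> in \<P>. (norm (grad_F (iterate t \<omega>)))\<^sup>2 \<le> M\<^sup>2"
      by (simp add: X)
  qed (fact assms)+
  show ?thesis
    using min_grad_le unfolding X C .
qed

end
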